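(* For every integer $n\ge 2$, ${}_n\mathrm{MVME}={}_n\mathrm{MME}^{*}$. More precisely, every random vector $X\in{}_n\mathrm{MVME}$ admits an ${}_n\mathrm{MME}^{*}$ representation $(\alpha,T,K)$ satisfying $\mathbf t=-T\mathbf 1$, $0\le \alpha\mathbf 1\le 1$, and $K\ge 0$ entrywise; that is, there exist $m\ge 1$, a row vector $\alpha\in\mathbb{R}^{1\times m}$ with $0\le\alpha\mathbf 1\le 1$, a Hurwitz-stable matrix $T\in\mathbb{R}^{m\times m}$ and an entrywise non-negative matrix $K\in\mathbb{R}^{m\times n}$ such that, with $\mathbf t=-T\mathbf 1$ and $p_0=1-\alpha\mathbf 1$, $$L_X(s)=p_0+\alpha\bigl(-T+\Delta(Ks)\bigr)^{-1}\mathbf t .$$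
   Context: Let $\mathbb{R}_+^n=[0,\infty)^n$. For a random vector $X$ with values in $\mathbb{R}_+^n$ its joint Laplace transform is $L_X(s)=\mathbb{E}[e^{-\langle s,X\rangle}]$, where $s=(s_1,\dots,s_n)^\top$ and $\langle s,x\rangle=\sum_j s_jx_j$. $\mathbf 1$ is the all-ones column vector of the appropriate size. For $v\in\mathbb{R}^m$, $\Delta(v)$ is the $m\times m$ diagonal matrix with diagonal entries $v_1,\dots,v_m$. A real square matrix is Hurwitz-stable if all its eigenvalues have strictly negative real part. Membership of $X$ in a class below means membership of its law. ${}_n\mathrm{MME}^{*}$: the class of random vectors $X$ in $\mathbb{R}_+^n$ for which there exist $m\ge1$, $p_0\in\mathbb{R}$, a row vector $\alpha\in\mathbb{R}^{1\times m}$, a Hurwitz-stable matrix $T\in\mathbb{R}^{m\times m}$, a column vector $\mathbf t\in\mathbb{R}^{m\times1}$ and a matrix $K\in\mathbb{R}^{m\times n}$ such that $L_X(s)=p_0+\alpha(-T+\Delta(Ks))^{-1}\mathbf t$ (as an identity of rational functions in $s$, i.e. on the common domain of definition). No sign or normalization constraints are imposed on $\alpha,T,K,\mathbf t$; the only requirement is that $L_X$ is the Laplace transform of a genuine probability measure on $\mathbb{R}_+^n$. Evaluation at $s=0$ gives $p_0=1-\alpha(-T)^{-1}\mathbf t$. ${}_n\mathrm{MVME}$: the class of random vectors $X$ in $\mathbb{R}_+^n$ whose joint Laplace transform $L_X(s)$ is a proper rational function of $(s_1,\dots,s_n)$, i.e. $L_X=P/Q$ with $P,Q$ real polynomials and the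 total degree of $P$ not exceeding that of $Q$. *)

theory Defs
  imports
    "HOL-Probability.Probability"
    "HOL-Library.Poly_Mapping"
    "Jordan_Normal_Form.Char_Poly"
    "Jordan_Normal_Form.Gauss_Jordan_Elimination"
begin

no_notation inner (infix "\<bullet>" 70)
unbundle no vec_syntax

notation Matrix.scalar_prod (infix "\<bullet>" 70)
notation Matrix.vec_index (infixl "$" 100)

text \<open>
  A random vector with values in the non-negative orthant of dimension \<open>n\<close> enters only through
  its law, a probability measure on the product of \<open>n\<close> copies of the Borel line that is
  concentrated on the orthant. The classes below are therefore sets of laws.
\<close>

definition nonneg_laws :: "nat \<Rightarrow> (nat \<Rightarrow> real) measure set" where
  "nonneg_laws n = {\<mu>. prob_space \<mu> \<and> sets \<mu> = sets (Pi\<^sub>M {..<n} (\<lambda>_. borel)) \<and>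
                        (AE x in \<mu>. \<forall>j<n. 0 \<le> x j)}"

definition laplace_kernel :: "nat \<Rightarrow> real Matrix.vec \<Rightarrow> (nat \<Rightarrow> real) \<Rightarrow> real" where
  "laplace_kernel n s x = exp (- (\<Sum>j<n. s $ j * x j))"

text \<open>The arguments at which the expectation is finite; they include the whole orthant.\<close>

definition laplace_domain :: "nat \<Rightarrow> (nat \<Rightarrow> real) measure \<Rightarrow> real Matrix.vec set" where
  "laplace_domain n \<mu> = {s \<in> carrier_vec n. integrable \<mu> (laplace_kernel n s)}"

definition laplace :: "nat \<Rightarrow> (nat \<Rightarrow> real) measure \<Rightarrow> real Matrix.vec \<Rightarrow> real" where
  "laplace n \<mu> s = integral\<^sup>L \<mu> (laplace_kernel n s)"

text \<open>
  A real polynomial in the variables with index below \<open>n\<close> is a finitely supported map from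
  exponent vectors to coefficients.
\<close>

type_synonym rpoly = "(nat \<Rightarrow>\<^sub>0 nat) \<Rightarrow>\<^sub>0 real"

definition polys :: "nat \<Rightarrow> rpoly set" where
  "polys n = {P. \<forall>a \<in> Poly_Mapping.keys P. Poly_Mapping.keys a \<subseteq> {..<n}}"

definition poly_val :: "nat \<Rightarrow> rpoly \<Rightarrow> real Matrix.vec \<Rightarrow> real" where
  "poly_val n P s =
     (\<Sum>a \<in> Poly_Mapping.keys P. Poly_Mapping.lookup P a * (\<Prod>j<n. s $ j ^ Poly_Mapping.lookup a j))"

text \<open>The zero polynomial gets total degree 0.\<close>

definition total_deg :: "nat \<Rightarrow> rpoly \<Rightarrow> nat" where
  "total_deg n P =
     Max (insert 0 ((\<lambda>a. \<Sum>j<n. Poly_Mapping.lookup a j) ` Poly_Mapping.keys P))"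

definition MVME :: "nat \<Rightarrow> (nat \<Rightarrow> real) measure set" where
  "MVME n = {\<mu> \<in> nonneg_laws n.
     \<exists>P \<in> polys n. \<exists>Q \<in> polys n. Q \<noteq> 0 \<and> total_deg n P \<le> total_deg n Q \<and>
       (\<forall>s \<in> laplace_domain n \<mu>. poly_val n Q s \<noteq> 0 \<longrightarrow>
          laplace n \<mu> s = poly_val n P s / poly_val n Q s)}"

definition hurwitz_stable :: "real Matrix.mat \<Rightarrow> bool" where
  "hurwitz_stable T \<longleftrightarrow> (\<forall>z. eigenvalue (map_mat complex_of_real T) z \<longrightarrow> Re z < 0)"

definition ones :: "nat \<Rightarrow> real Matrix.vec" where
  "ones m = Matrix.vec m (\<lambda>_. 1)"

definition resolvent_arg :: "nat \<Rightarrow> real Matrix.mat \<Rightarrow> real Matrix.mat \<Rightarrow> real Matrix.vec \<Rightarrow> real Matrix.mat" where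
  "resolvent_arg m T K s = - T + mat_diag m (\<lambda>i. (K *\<^sub>v s) $ i)"

text \<open>
  The identity is one of rational functions: it is required wherever the transform is finite and
  the matrix is invertible. Stability of \<open>T\<close> makes \<open>- T\<close> invertible, so the determinant is not the
  zero polynomial. The function \<^const>\<open>mat_inverse\<close> returns \<^const>\<open>None\<close> on singular matrices.
\<close>

definition MME_representation ::
    "nat \<Rightarrow> (nat \<Rightarrow> real) measure \<Rightarrow> nat \<Rightarrow> real \<Rightarrow> real Matrix.vec \<Rightarrow> real Matrix.mat \<Rightarrow>
     real Matrix.vec \<Rightarrow> real Matrix.mat \<Rightarrow> bool" where
  "MME_representation n \<mu> m p0 \<alpha> T t K \<longleftrightarrow>
     1 \<le> m \<and> \<alpha> \<in> carrier_vec m \<and> T \<in> carrier_mat m m \<and> t \<in> carrier_vec m \<and> K \<in> carrier_mat m n \<and>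
     hurwitz_stable T \<and>
     (\<forall>s \<in> laplace_domain n \<mu>. \<forall>R. mat_inverse (resolvent_arg m T K s) = Some R \<longrightarrow>
        laplace n \<mu> s = p0 + \<alpha> \<bullet> (R *\<^sub>v t))"

definition MME_star :: "nat \<Rightarrow> (nat \<Rightarrow> real) measure set" where
  "MME_star n = {\<mu> \<in> nonneg_laws n. \<exists>m p0 \<alpha> T t K. MME_representation n \<mu> m p0 \<alpha> T t K}"

end

theory Submission
  imports Defs
begin

text \<open>
  A representation gives a rational transform by Cramer's rule. The quotient is proper because a
  Laplace transform is bounded by 1 on the orthant, so its numerator cannot outgrow its denominator
  along a ray.

  Conversely, let the transform be \<open>L = P / Q\<close>. If \<open>L = V / U\<close> with \<open>U(0) = 1\<close>, a
  representation is a matter of linear algebra. The transform is then \<open>c \<bullet> x\<close>, where \<open>x\<close> solves a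
  sparse system \<open>(A + \<Delta>(K s)) x = b\<close> whose unknowns are \<open>1 / U\<close> times products of the factors
  \<open>s\<^sub>j + 1\<close> (lemma \<open>rational_function_realization\<close>). The entries of \<open>K\<close> are 0 and 1, and at
  \<open>s = 0\<close> every unknown equals 1, so \<open>b = A 1\<close>. Invertibility of \<open>A\<close> is weaker than stability of
  \<open>- A\<close>, but the zero rows that \<open>K\<close> may have leave room to repair this: \<open>A\<close> is a Schur complement
  of a matrix of twice the size whose eigenvalues \<open>z\<close> all make \<open>z + 1 / z - p\<close> an eigenvalue of
  \<open>A\<^sup>-\<^sup>1\<close>, where \<open>p\<close> is at our disposal. A large \<open>p\<close> forces \<open>Re z > 0\<close>
  (lemmas \<open>stab_eigenvalue_positive\<close> and \<open>stable_representation\<close>).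

  The heart of the matter is therefore to find \<open>U\<close> and \<open>V\<close>, for \<open>Q\<close> may vanish at 0. Two facts are
  combined.

  \<^item> The law has moments of all orders, because along a ray the transform is a rational function of
    one variable and bounded. Hence \<open>L\<close> has a Taylor polynomial \<open>L\<^sub>k\<close> of each order at 0, and
    \<open>R\<^sub>k = P - Q L\<^sub>k\<close> has only terms of degrees \<open>k + 1, \<dots>, k + d\<close>, with \<open>d\<close> independent of \<open>k\<close>.
    So \<open>P\<close> belongs to the ideal generated by \<open>Q\<close> up to every power of the maximal ideal at 0.

  \<^item> This is the situation of Krull's intersection theorem, and it is settled as in Perdry's proof.
    The \<open>R\<^sub>k\<close> correspond to homogeneous vectors over a Noetherian ring, so some \<open>R\<^sub>k\<close> is a combination
    \<open>\<Sum>i<k. b\<^sub>i R\<^sub>i\<close> with \<open>b\<^sub>i\<close> homogeneous of degree \<open>k - i > 0\<close>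
    (lemma \<open>homogeneous_sequence_dependent\<close>). Then \<open>U = 1 - \<Sum>i<k. b\<^sub>i\<close> and
    \<open>V = L\<^sub>k - \<Sum>i<k. b\<^sub>i L\<^sub>i\<close> satisfy \<open>U P = Q V\<close> and \<open>U(0) = 1\<close>
    (lemma \<open>denominator_normalizable\<close>).
\<close>

section \<open>Polynomials as functions\<close>

definition monomial_val :: "nat \<Rightarrow> (nat \<Rightarrow>\<^sub>0 nat) \<Rightarrow> real Matrix.vec \<Rightarrow> real" where
  "monomial_val n a s = (\<Prod>j<n. s $ j ^ Poly_Mapping.lookup a j)"

definition exponent_sum :: "nat \<Rightarrow> (nat \<Rightarrow>\<^sub>0 nat) \<Rightarrow> nat" where
  "exponent_sum n a = (\<Sum>j<n. Poly_Mapping.lookup a j)"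

lemma exponent_sum_add: "exponent_sum n (a + b) = exponent_sum n a + exponent_sum n b"
  by (simp add: exponent_sum_def lookup_add sum.distrib)

lemma exponent_sum_Suc: "exponent_sum (Suc n) a = exponent_sum n a + Poly_Mapping.lookup a n"
  by (simp add: exponent_sum_def)

lemma exponent_sum_0 [simp]: "exponent_sum n 0 = 0"
  by (simp add: exponent_sum_def)

lemma exponent_sum_le_total_deg: "a \<in> Poly_Mapping.keys P \<Longrightarrow> exponent_sum n a \<le> total_deg n P"
  unfolding total_deg_def exponent_sum_def by (intro Max_ge) auto

lemma poly_val_superset:
  assumes "finite A" "Poly_Mapping.keys P \<subseteq> A"
  shows "poly_val n P s = (\<Sum>a\<in>A. Poly_Mapping.lookup P a * monomial_val n a s)"
  unfolding poly_val_def monomial_val_def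
  by (rule sum.mono_neutral_left[OF assms]) (auto simp: in_keys_iff)

lemma poly_val_0 [simp]: "poly_val n 0 s = 0"
  by (simp add: poly_val_def)

lemma poly_val_single: "poly_val n (Poly_Mapping.single a c) s = c * monomial_val n a s"
  by (subst poly_val_superset[of "{a}"]) (auto split: if_splits)

lemma poly_val_add: "poly_val n (P + Q) s = poly_val n P s + poly_val n Q s"
proof -
  let ?A = "Poly_Mapping.keys P \<union> Poly_Mapping.keys Q"
  have "Poly_Mapping.keys (P + Q) \<subseteq> ?A" by (rule keys_add)
  then show ?thesis
    by (simp add: poly_val_superset[of ?A] lookup_add algebra_simps sum.distrib)
qed

lemma poly_val_sum: "poly_val n (\<Sum>i\<in>I. f i) s = (\<Sum>i\<in>I. poly_val n (f i) s)"
  by (induction I rule: infinite_finite_induct) (auto simp: poly_val_add)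

lemma rpoly_sum_monomials:
  "P = (\<Sum>a\<in>Poly_Mapping.keys P. Poly_Mapping.single a (Poly_Mapping.lookup P a))"
  by (rule poly_mapping_eqI) (auto simp: lookup_sum lookup_single when_def not_in_keys_iff_lookup_eq_zero)

lemma rpoly_mult_monomials:
  fixes P Q :: rpoly
  shows "P * Q = (\<Sum>a\<in>Poly_Mapping.keys P. \<Sum>b\<in>Poly_Mapping.keys Q.
           Poly_Mapping.single (a + b) (Poly_Mapping.lookup P a * Poly_Mapping.lookup Q b))"
  by (subst rpoly_sum_monomials[of P], subst rpoly_sum_monomials[of Q])
     (simp add: sum_product mult_single)

lemma monomial_val_add: "monomial_val n (a + b) s = monomial_val n a s * monomial_val n b s"
  by (simp add: monomial_val_def lookup_add power_add prod.distrib)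

lemma poly_val_mult: "poly_val n (P * Q) s = poly_val n P s * poly_val n Q s"
  unfolding rpoly_mult_monomials poly_val_sum poly_val_single monomial_val_add
  by (simp add: sum_product poly_val_def monomial_val_def[symmetric] mult_ac)

lemma poly_val_1 [simp]: "poly_val n 1 s = 1"
  by (simp add: single_one[symmetric] poly_val_single monomial_val_def del: single_one)

lemma poly_val_const [simp]: "poly_val n (Poly_Mapping.single 0 c) s = c"
  by (simp add: poly_val_single monomial_val_def)

lemma poly_val_prod: "poly_val n (\<Prod>i\<in>I. f i) s = (\<Prod>i\<in>I. poly_val n (f i) s)"
  by (induction I rule: infinite_finite_induct) (auto simp: poly_val_mult)

lemma poly_val_uminus: "poly_val n (- P) s = - poly_val n P s"
  using poly_val_add[of n P "- P" s] by simp

lemma poly_val_diff: "poly_val n (P - Q) s = poly_val n P s - poly_val n Q s"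
  using poly_val_add[of n P "- Q" s] by (simp add: poly_val_uminus)

definition rvar :: "nat \<Rightarrow> rpoly" where
  "rvar j = Poly_Mapping.single (Poly_Mapping.single j 1) 1"

lemma poly_val_rvar: "j < n \<Longrightarrow> poly_val n (rvar j) s = s $ j"
  by (simp add: rvar_def poly_val_single monomial_val_def lookup_single when_def
      if_distrib[of "\<lambda>e. _ ^ e"] cong: if_cong)

lemma comm_ring_hom_poly_val: "comm_ring_hom (\<lambda>P. poly_val n P s)"
  by unfold_locales (auto simp: poly_val_add poly_val_mult)

lemma keys_mult_elim:
  assumes "c \<in> Poly_Mapping.keys (P * Q :: rpoly)"
  obtains a b where "a \<in> Poly_Mapping.keys P" "b \<in> Poly_Mapping.keys Q" "c = a + b"
  using keys_mult[of P Q] assms by auto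

lemma keys_rpoly_diff:
  "Poly_Mapping.keys (P - Q :: rpoly) \<subseteq> Poly_Mapping.keys P \<union> Poly_Mapping.keys Q"
  by (auto simp: in_keys_iff lookup_minus)

lemma keys_exponent_add:
  "Poly_Mapping.keys (a + b :: nat \<Rightarrow>\<^sub>0 nat) = Poly_Mapping.keys a \<union> Poly_Mapping.keys b"
  by (auto simp: in_keys_iff lookup_add)

lemma polys_add: "P \<in> polys n \<Longrightarrow> Q \<in> polys n \<Longrightarrow> P + Q \<in> polys n"
  using keys_add[of P Q] unfolding polys_def by blast

lemma polys_diff: "P \<in> polys n \<Longrightarrow> Q \<in> polys n \<Longrightarrow> P - Q \<in> polys n"
  using keys_rpoly_diff[of P Q] unfolding polys_def by blast

lemma polys_mult: "P \<in> polys n \<Longrightarrow> Q \<in> polys n \<Longrightarrow> P * Q \<in> polys n"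
  unfolding polys_def mem_Collect_eq
  by (intro ballI, elim keys_mult_elim, hypsubst, unfold keys_exponent_add, intro Un_least) blast+

lemma polys_const: "Poly_Mapping.single 0 c \<in> polys n"
  by (auto simp: polys_def split: if_splits)

lemma polys_0: "0 \<in> polys n"
  by (auto simp: polys_def)

lemma polys_1: "1 \<in> polys n"
  by (auto simp: polys_def)

lemma polys_uminus: "P \<in> polys n \<Longrightarrow> - P \<in> polys n"
  using polys_diff[OF polys_0, of P n] by simp

lemma polys_rvar: "j < n \<Longrightarrow> rvar j \<in> polys n"
  by (auto simp: polys_def rvar_def)

lemma polys_sum: "(\<And>i. i \<in> I \<Longrightarrow> f i \<in> polys n) \<Longrightarrow> (\<Sum>i\<in>I. f i) \<in> polys n"
  by (induction I rule: infinite_finite_induct) (auto simp: polys_0 polys_add)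

lemma polys_prod: "(\<And>i. i \<in> I \<Longrightarrow> f i \<in> polys n) \<Longrightarrow> (\<Prod>i\<in>I. f i) \<in> polys n"
  by (induction I rule: infinite_finite_induct) (auto simp: polys_1 polys_mult)

text \<open>Induction on the number of variables: once the other variables have values at which the
  coefficient of some power of the last one does not vanish, all but finitely many values of the
  last variable work.\<close>

lemma exists_nonzero_value_large:
  fixes c :: "(nat \<Rightarrow>\<^sub>0 nat) \<Rightarrow> real" and C :: "nat \<Rightarrow> real"
  assumes "finite A" "a0 \<in> A" "c a0 \<noteq> 0"
    and "\<And>a b. a \<in> A \<Longrightarrow> b \<in> A \<Longrightarrow> (\<And>j. j < n \<Longrightarrow> Poly_Mapping.lookup a j = Poly_Mapping.lookup b j) \<Longrightarrow> a = b"
  shows "\<exists>s::nat \<Rightarrow> real. (\<forall>j. s j > C j) \<and> (\<Sum>a\<in>A. c a * (\<Prod>j<n. s j ^ Poly_Mapping.lookup a j)) \<noteq> 0"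
  using assms
proof (induction n arbitrary: A)
  case 0
  then have "A = {a0}" by auto
  then show ?case using 0 by (auto intro!: exI[of _ "\<lambda>j. C j + 1"])
next
  case (Suc n)
  define e where "e = Poly_Mapping.lookup a0 n"
  define B where "B = {a\<in>A. Poly_Mapping.lookup a n = e}"
  have "\<exists>s::nat \<Rightarrow> real. (\<forall>j. s j > C j) \<and> (\<Sum>a\<in>B. c a * (\<Prod>j<n. s j ^ Poly_Mapping.lookup a j)) \<noteq> 0"
  proof (rule Suc.IH)
    show "finite B" "a0 \<in> B" "c a0 \<noteq> 0" using Suc.prems by (auto simp: B_def e_def)
    show "a = b" if "a \<in> B" "b \<in> B" "\<And>j. j < n \<Longrightarrow> Poly_Mapping.lookup a j = Poly_Mapping.lookup b j" for a b
    proof (rule Suc.prems(4))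
      show "Poly_Mapping.lookup a j = Poly_Mapping.lookup b j" if "j < Suc n" for j
        using that \<open>a \<in> B\<close> \<open>b \<in> B\<close> \<open>\<And>j. j < n \<Longrightarrow> _ j = _ j\<close>[of j]
        by (auto simp: B_def less_Suc_eq)
    qed (use that in \<open>auto simp: B_def\<close>)
  qed
  then obtain s where s: "\<And>j. s j > C j" "(\<Sum>a\<in>B. c a * (\<Prod>j<n. s j ^ Poly_Mapping.lookup a j)) \<noteq> 0"
    by blast
  define g :: "real poly" where
    "g = (\<Sum>a\<in>A. monom (c a * (\<Prod>j<n. s j ^ Poly_Mapping.lookup a j)) (Poly_Mapping.lookup a n))"
  have "coeff g e = (\<Sum>a\<in>A. if Poly_Mapping.lookup a n = e then c a * (\<Prod>j<n. s j ^ Poly_Mapping.lookup a j) else 0)"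
    by (simp add: g_def coeff_sum)
  also have "\<dots> = (\<Sum>a\<in>B. c a * (\<Prod>j<n. s j ^ Poly_Mapping.lookup a j))"
    using Suc.prems(1) by (simp add: B_def sum.inter_filter)
  finally have "g \<noteq> 0" using s by auto
  then have "finite {x. poly g x = 0}" by (rule poly_roots_finite)
  then have "\<exists>x. x > C n \<and> x \<notin> {x. poly g x = 0}"
    using infinite_Ioi[of "C n"] by (metis (no_types, lifting) finite_subset greaterThan_iff subsetI)
  then obtain x where x: "x > C n" "poly g x \<noteq> 0" by auto
  have "(\<Sum>a\<in>A. c a * (\<Prod>j<Suc n. (s(n := x)) j ^ Poly_Mapping.lookup a j)) = poly g x"
    by (simp add: g_def poly_sum poly_monom mult_ac)
  with x s show ?case by (intro exI[of _ "s(n := x)"]) auto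
qed

lemma exponents_determined:
  assumes "P \<in> polys n" "a \<in> Poly_Mapping.keys P" "b \<in> Poly_Mapping.keys P"
    and "\<And>j. j < n \<Longrightarrow> Poly_Mapping.lookup a j = Poly_Mapping.lookup b j"
  shows "a = b"
proof (rule poly_mapping_eqI)
  fix j show "Poly_Mapping.lookup a j = Poly_Mapping.lookup b j"
  proof (cases "j < n")
    case False
    then have "j \<notin> Poly_Mapping.keys a" "j \<notin> Poly_Mapping.keys b"
      using assms(1-3) by (auto simp: polys_def)
    then show ?thesis by (simp add: not_in_keys_iff_lookup_eq_zero)
  qed (rule assms(4))
qed

lemma exists_poly_val_nonzero_large:
  fixes C :: "nat \<Rightarrow> real"
  assumes "P \<in> polys n" "P \<noteq> 0"
  obtains s where "s \<in> carrier_vec n" "\<And>j. j < n \<Longrightarrow> s $ j > C j" "poly_val n P s \<noteq> 0"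
proof -
  from assms(2) obtain a0 where "a0 \<in> Poly_Mapping.keys P"
    by (metis ex_in_conv keys_eq_empty)
  then have a0: "Poly_Mapping.lookup P a0 \<noteq> 0" by (simp add: in_keys_iff)
  have "\<exists>s::nat \<Rightarrow> real. (\<forall>j. s j > C j) \<and>
    (\<Sum>a\<in>Poly_Mapping.keys P. Poly_Mapping.lookup P a * (\<Prod>j<n. s j ^ Poly_Mapping.lookup a j)) \<noteq> 0"
    using finite_keys \<open>a0 \<in> Poly_Mapping.keys P\<close>
    by (rule exists_nonzero_value_large) (fact a0, rule exponents_determined[OF assms(1)])
  then obtain s :: "nat \<Rightarrow> real" where s: "\<And>j. s j > C j"
    "(\<Sum>a\<in>Poly_Mapping.keys P. Poly_Mapping.lookup P a * (\<Prod>j<n. s j ^ Poly_Mapping.lookup a j)) \<noteq> 0"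
    by blast
  have "poly_val n P (Matrix.vec n s) =
      (\<Sum>a\<in>Poly_Mapping.keys P. Poly_Mapping.lookup P a * (\<Prod>j<n. s j ^ Poly_Mapping.lookup a j))"
    unfolding poly_val_def
    by (intro sum.cong refl arg_cong2[where f = "(*)"] prod.cong) simp
  with s show thesis by (intro that[of "Matrix.vec n s"]) auto
qed

section \<open>A Noetherian argument for graded sequences\<close>

lemma nondecreasing_subsequence:
  fixes f :: "nat \<Rightarrow> nat"
  obtains r :: "nat \<Rightarrow> nat" where "strict_mono r" "\<And>i j. i \<le> j \<Longrightarrow> f (r i) \<le> f (r j)"
proof -
  obtain g where g: "strict_mono g" "monoseq (\<lambda>k. f (g k))" using seq_monosub[of f] by blast
  from g(2) consider "\<forall>i j. i \<le> j \<longrightarrow> f (g i) \<le> f (g j)" | "\<forall>i j. i \<le> j \<longrightarrow> f (g j) \<le> f (g i)"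
    unfolding monoseq_def by blast
  then show thesis
  proof cases
    case 1
    with g(1) show thesis by (intro that[of g]) auto
  next
    case 2
    \<comment> \<open>A non-increasing sequence of naturals is constant from the place on where its minimum occurs.\<close>
    obtain N where N: "\<And>k. f (g N) \<le> f (g k)"
      using ex_has_least_nat[of "\<lambda>_. True" _ "\<lambda>k. f (g k)"] by auto
    show thesis
    proof (rule that[of "\<lambda>k. g (N + k)"])
      show "strict_mono (\<lambda>k. g (N + k))"
        using g(1) by (auto simp: strict_mono_def)
      show "f (g (N + i)) \<le> f (g (N + j))" for i j
        using N[of "N + j"] 2 by (meson le_add1 le_trans)
    qed
  qed
qed

text \<open>Functions on the naturals take the place of monomials, so that coordinates other than exponents can
  be added to a sequence of exponent vectors.\<close>

lemma Dickson_subsequence: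
  fixes f :: "nat \<Rightarrow> nat \<Rightarrow> nat"
  shows "\<exists>r::nat \<Rightarrow> nat. strict_mono r \<and> (\<forall>v<N. \<forall>i j. i \<le> j \<longrightarrow> f (r i) v \<le> f (r j) v)"
proof (induction N)
  case 0
  show ?case by (rule exI[of _ id]) (auto simp: strict_mono_def)
next
  case (Suc N)
  then obtain r :: "nat \<Rightarrow> nat" where r: "strict_mono r" "\<And>v i j. v < N \<Longrightarrow> i \<le> j \<Longrightarrow> f (r i) v \<le> f (r j) v" by blast
  obtain q :: "nat \<Rightarrow> nat" where q: "strict_mono q" "\<And>i j. i \<le> j \<Longrightarrow> f (r (q i)) N \<le> f (r (q j)) N"
    using nondecreasing_subsequence[of "\<lambda>k. f (r k) N"] by blast
  have "f (r (q i)) v \<le> f (r (q j)) v" if "v < Suc N" "i \<le> j" for v i j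
    using that q r(2)[of v "q i" "q j"] by (cases "v = N") (auto simp: strict_mono_less_eq)
  moreover have "strict_mono (\<lambda>k. r (q k))" using strict_mono_o[OF r(1) q(1)] by (simp add: o_def)
  ultimately show ?case by (intro exI[of _ "\<lambda>k. r (q k)"] conjI allI impI)
qed

lemma Dickson:
  fixes f :: "nat \<Rightarrow> nat \<Rightarrow> nat"
  obtains i j where "i < j" "\<And>v. v < N \<Longrightarrow> f i v \<le> f j v"
proof -
  obtain r :: "nat \<Rightarrow> nat" where "strict_mono r" "\<And>v i j. v < N \<Longrightarrow> i \<le> j \<Longrightarrow> f (r i) v \<le> f (r j) v"
    using Dickson_subsequence[of N f] by blast
  then show thesis by (intro that[of "r 0" "r 1"]) (auto simp: strict_mono_def)
qed

lemma exponent_le_lex: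
  fixes a b :: "nat \<Rightarrow>\<^sub>0 nat"
  assumes "\<And>v. Poly_Mapping.lookup a v \<le> Poly_Mapping.lookup b v"
  shows "a \<le> b"
proof (cases "a = b")
  case False
  define v where "v = (LEAST v. Poly_Mapping.lookup a v \<noteq> Poly_Mapping.lookup b v)"
  have ex: "\<exists>v. Poly_Mapping.lookup a v \<noteq> Poly_Mapping.lookup b v"
    using False by (meson poly_mapping_eqI)
  have "Poly_Mapping.lookup a v \<noteq> Poly_Mapping.lookup b v"
    using ex unfolding v_def by (rule LeastI_ex)
  then have "Poly_Mapping.lookup a v < Poly_Mapping.lookup b v" using assms[of v] by simp
  moreover have "Poly_Mapping.lookup a w = Poly_Mapping.lookup b w" if "w < v" for w
    using that not_less_Least[of w] unfolding v_def by blast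
  ultimately have "a < b" by (auto simp: less_poly_mapping.rep_eq less_fun_def)
  then show ?thesis by simp
qed auto

text \<open>An infinite descent would contradict Dickson's lemma, because the lexicographic order extends
  divisibility of monomials.\<close>

lemma wf_lex:
  "wf {(a, b :: nat \<Rightarrow>\<^sub>0 nat). a < b \<and> Poly_Mapping.keys a \<subseteq> {..<N} \<and> Poly_Mapping.keys b \<subseteq> {..<N}}"
proof (subst wf_iff_no_infinite_down_chain, rule notI, elim exE)
  fix g :: "nat \<Rightarrow> nat \<Rightarrow>\<^sub>0 nat"
  assume g: "\<forall>i. (g (Suc i), g i) \<in> {(a, b). a < b \<and> Poly_Mapping.keys a \<subseteq> {..<N} \<and> Poly_Mapping.keys b \<subseteq> {..<N}}"
  have dec: "g j < g i" if "i < j" for i j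
    using that g by (induction rule: less_Suc_induct) (auto intro: less_trans)
  obtain i j where ij: "i < j" "\<And>v. v < N \<Longrightarrow> Poly_Mapping.lookup (g i) v \<le> Poly_Mapping.lookup (g j) v"
    using Dickson[of N "\<lambda>i. Poly_Mapping.lookup (g i)"] by blast
  have "Poly_Mapping.lookup (g i) v \<le> Poly_Mapping.lookup (g j) v" for v
  proof (cases "v < N")
    case False
    then have "v \<notin> Poly_Mapping.keys (g i)" using g by auto
    then show ?thesis by (simp add: not_in_keys_iff_lookup_eq_zero)
  qed (rule ij)
  then have "g i \<le> g j" by (rule exponent_le_lex)
  with dec[OF ij(1)] show False by simp
qed

definition lead_exp :: "rpoly \<Rightarrow> nat \<Rightarrow>\<^sub>0 nat" where
  "lead_exp P = Max (Poly_Mapping.keys P)"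

lemma lead_exp_in: "P \<noteq> 0 \<Longrightarrow> lead_exp P \<in> Poly_Mapping.keys P"
  by (simp add: lead_exp_def)

lemma lead_exp_ge: "a \<in> Poly_Mapping.keys P \<Longrightarrow> a \<le> lead_exp P"
  by (simp add: lead_exp_def)

lemma lookup_single_mult_add:
  "Poly_Mapping.lookup (Poly_Mapping.single b c * P :: rpoly) (b + a) = c * Poly_Mapping.lookup P a"
proof -
  have "Poly_Mapping.single b c * P =
      (\<Sum>a\<in>Poly_Mapping.keys P. Poly_Mapping.single (b + a) (c * Poly_Mapping.lookup P a))"
    by (subst rpoly_sum_monomials[of P]) (simp add: sum_distrib_left mult_single)
  then show ?thesis
    by (auto simp: lookup_sum lookup_single when_def not_in_keys_iff_lookup_eq_zero)
qed

text \<open>One step of polynomial division: the multiple of \<open>G\<close> is chosen so that the leading terms cancel.\<close>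

lemma lead_exp_reduce:
  assumes "P \<noteq> 0" "G \<noteq> 0" "lead_exp P = b + lead_exp G"
  obtains c where "P - Poly_Mapping.single b c * G = 0 \<or>
    lead_exp (P - Poly_Mapping.single b c * G) < lead_exp P"
proof -
  define c where "c = Poly_Mapping.lookup P (lead_exp P) / Poly_Mapping.lookup G (lead_exp G)"
  define D where "D = P - Poly_Mapping.single b c * G"
  have G: "Poly_Mapping.lookup G (lead_exp G) \<noteq> 0"
    using lead_exp_in[OF assms(2)] by (simp add: in_keys_iff)
  have "Poly_Mapping.lookup D (lead_exp P) = 0"
    unfolding D_def lookup_minus using G
    by (subst (2) assms(3), subst lookup_single_mult_add) (simp add: c_def)
  moreover have "a \<le> lead_exp P" if a: "a \<in> Poly_Mapping.keys D" for a
  proof -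
    have "a \<in> Poly_Mapping.keys P \<or> a \<in> Poly_Mapping.keys (Poly_Mapping.single b c * G)"
      using a keys_rpoly_diff[of P] unfolding D_def by blast
    then show ?thesis
    proof
      assume "a \<in> Poly_Mapping.keys (Poly_Mapping.single b c * G)"
      then obtain d where "d \<in> Poly_Mapping.keys G" "a = b + d"
        by (elim keys_mult_elim) (auto split: if_splits)
      then show ?thesis unfolding assms(3) by (simp add: add_left_mono lead_exp_ge)
    qed (rule lead_exp_ge)
  qed
  ultimately have "D = 0 \<or> lead_exp D < lead_exp P"
    using lead_exp_in[of D] by (metis in_keys_iff order_le_imp_less_or_eq)
  then show thesis using that unfolding D_def by blast
qed

definition homogeneous :: "nat \<Rightarrow> nat \<Rightarrow> rpoly set" where
  "homogeneous n m = {b. \<forall>a\<in>Poly_Mapping.keys b. Poly_Mapping.keys a \<subseteq> {..<n} \<and> exponent_sum n a = m}"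

lemma homogeneous_0: "0 \<in> homogeneous n m"
  by (simp add: homogeneous_def)

lemma homogeneous_add: "P \<in> homogeneous n m \<Longrightarrow> Q \<in> homogeneous n m \<Longrightarrow> P + Q \<in> homogeneous n m"
  using keys_add[of P Q] unfolding homogeneous_def by blast

lemma homogeneous_diff: "P \<in> homogeneous n m \<Longrightarrow> Q \<in> homogeneous n m \<Longrightarrow> P - Q \<in> homogeneous n m"
  using keys_rpoly_diff[of P Q] unfolding homogeneous_def by blast

lemma homogeneous_mult:
  assumes "P \<in> homogeneous n k" "Q \<in> homogeneous n l"
  shows "P * Q \<in> homogeneous n (k + l)"
  unfolding homogeneous_def
proof (intro CollectI ballI)
  fix c assume "c \<in> Poly_Mapping.keys (P * Q)"
  then obtain a b where "a \<in> Poly_Mapping.keys P" "b \<in> Poly_Mapping.keys Q" "c = a + b"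
    by (rule keys_mult_elim)
  with assms show "Poly_Mapping.keys c \<subseteq> {..<n} \<and> exponent_sum n c = k + l"
    unfolding homogeneous_def keys_exponent_add \<open>c = a + b\<close> exponent_sum_add by auto
qed

lemma homogeneous_single:
  "Poly_Mapping.keys a \<subseteq> {..<n} \<Longrightarrow> exponent_sum n a = m \<Longrightarrow> Poly_Mapping.single a c \<in> homogeneous n m"
  by (auto simp: homogeneous_def)

lemma homogeneous_sum: "(\<And>i. i \<in> I \<Longrightarrow> f i \<in> homogeneous n m) \<Longrightarrow> (\<Sum>i\<in>I. f i) \<in> homogeneous n m"
  by (induction I rule: infinite_finite_induct) (auto simp: homogeneous_0 homogeneous_add)

lemma homogeneous_const: "Poly_Mapping.single 0 c \<in> homogeneous n 0"
  by (rule homogeneous_single) auto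

lemma homogeneous_rvar: "j < n \<Longrightarrow> rvar j \<in> homogeneous n 1"
  unfolding rvar_def by (rule homogeneous_single) (auto simp: exponent_sum_def lookup_single when_def)

lemma homogeneous_prod:
  "(\<And>l. l < (i::nat) \<Longrightarrow> f l \<in> homogeneous n 1) \<Longrightarrow> (\<Prod>l<i. f l) \<in> homogeneous n i"
proof (induction i)
  case 0
  show ?case using homogeneous_const[of 1 n] by simp
next
  case (Suc i)
  then have "(\<Prod>l<i. f l) * f i \<in> homogeneous n (i + 1)" by (intro homogeneous_mult) auto
  then show ?case by simp
qed

lemma poly_val_homogeneous_at_0:
  assumes "b \<in> homogeneous n m" "m > 0"
  shows "poly_val n b (0\<^sub>v n) = 0"
proof -
  have "monomial_val n a (0\<^sub>v n) = 0" if "a \<in> Poly_Mapping.keys b" for a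
  proof -
    have "exponent_sum n a > 0" using assms that by (auto simp: homogeneous_def)
    then have "\<exists>j<n. Poly_Mapping.lookup a j \<noteq> 0"
      by (rule contrapos_pp) (simp add: exponent_sum_def)
    then obtain j where j: "j < n" "Poly_Mapping.lookup a j \<noteq> 0" by blast
    then have "(0\<^sub>v n :: real Matrix.vec) $ j ^ Poly_Mapping.lookup a j = 0" by simp
    with j(1) show ?thesis unfolding monomial_val_def by (intro prod_zero) auto
  qed
  then show ?thesis unfolding poly_val_def monomial_val_def[symmetric] by (intro sum.neutral) simp
qed

text \<open>The combinations of \<open>F 0, \<dots>, F (k - 1)\<close> that have the degree of \<open>F k\<close> when each \<open>F i\<close> is
  homogeneous of degree \<open>i + d\<close>. The multipliers involve only the variables below \<open>n\<close>, whereas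
  \<open>F\<close> may contain one more variable: its powers play the role of the basis of a free module.\<close>

definition homogeneous_combinations :: "nat \<Rightarrow> (nat \<Rightarrow> rpoly) \<Rightarrow> nat \<Rightarrow> rpoly set" where
  "homogeneous_combinations n F k = {\<Sum>i<k. b i * F i | b. \<forall>i<k. b i \<in> homogeneous n (k - i)}"

lemma homogeneous_combinations_0: "0 \<in> homogeneous_combinations n F k"
  unfolding homogeneous_combinations_def by (rule CollectI, rule exI[of _ "\<lambda>_. 0"]) (simp add: homogeneous_0)

lemma homogeneous_combinations_add:
  assumes "v \<in> homogeneous_combinations n F k" "w \<in> homogeneous_combinations n F k"
  shows "v + w \<in> homogeneous_combinations n F k"
proof -
  obtain b c where "\<forall>i<k. b i \<in> homogeneous n (k - i)" "v = (\<Sum>i<k. b i * F i)"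
    "\<forall>i<k. c i \<in> homogeneous n (k - i)" "w = (\<Sum>i<k. c i * F i)"
    using assms unfolding homogeneous_combinations_def by blast
  then show ?thesis unfolding homogeneous_combinations_def
    by (intro CollectI exI[of _ "\<lambda>i. b i + c i"]) (simp add: homogeneous_add distrib_right sum.distrib)
qed

lemma homogeneous_combinations_diff:
  assumes "v \<in> homogeneous_combinations n F k" "w \<in> homogeneous_combinations n F k"
  shows "v - w \<in> homogeneous_combinations n F k"
proof -
  obtain b c where "\<forall>i<k. b i \<in> homogeneous n (k - i)" "v = (\<Sum>i<k. b i * F i)"
    "\<forall>i<k. c i \<in> homogeneous n (k - i)" "w = (\<Sum>i<k. c i * F i)"
    using assms unfolding homogeneous_combinations_def by blast
  then show ?thesis unfolding homogeneous_combinations_def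
    by (intro CollectI exI[of _ "\<lambda>i. b i - c i"]) (simp add: homogeneous_diff left_diff_distrib sum_subtractf)
qed

lemma homogeneous_combinations_sum:
  "(\<And>i. i \<in> I \<Longrightarrow> f i \<in> homogeneous_combinations n F k) \<Longrightarrow> (\<Sum>i\<in>I. f i) \<in> homogeneous_combinations n F k"
  by (induction I rule: infinite_finite_induct)
    (simp_all add: homogeneous_combinations_0 homogeneous_combinations_add)

lemma homogeneous_combinations_generator:
  assumes "i < k" "p \<in> homogeneous n (k - i)"
  shows "p * F i \<in> homogeneous_combinations n F k"
proof -
  have "(\<Sum>l<k. (if l = i then p else 0) * F l) = (\<Sum>l<k. if l = i then p * F l else 0)"
    by (intro sum.cong) auto
  also have "\<dots> = p * F i" using assms(1) by simp
  finally have "p * F i = (\<Sum>l<k. (if l = i then p else 0) * F l)" by simp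
  then show ?thesis unfolding homogeneous_combinations_def using assms
    by (intro CollectI exI[of _ "\<lambda>l. if l = i then p else 0"]) (auto simp: homogeneous_0)
qed

lemma homogeneous_combinations_mult:
  assumes "i < k" "p \<in> homogeneous n (k - i)" "w \<in> homogeneous_combinations n F i"
  shows "p * w \<in> homogeneous_combinations n F k"
proof -
  obtain b where b: "\<forall>l<i. b l \<in> homogeneous n (i - l)" "w = (\<Sum>l<i. b l * F l)"
    using assms(3) unfolding homogeneous_combinations_def by blast
  have pw: "p * w = (\<Sum>l\<in>{..<i}. (p * b l) * F l)"
    by (simp add: b(2) sum_distrib_left mult.assoc)
  have "(p * b l) * F l \<in> homogeneous_combinations n F k" if "l < i" for l
  proof (rule homogeneous_combinations_generator)
    show "p * b l \<in> homogeneous n (k - l)"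
      using that assms(1) b(1) homogeneous_mult[OF assms(2), of "b l" "i - l"] by simp
  qed (use that assms(1) in simp)
  then show ?thesis unfolding pw by (intro homogeneous_combinations_sum) simp
qed

text \<open>The graded form of the Hilbert basis theorem for a free module of finite rank. If the claim failed,
  each \<open>F k\<close> could be reduced by combinations of its predecessors to a nonzero remainder with the
  least possible leading exponent. By Dickson's lemma one of these exponents divides a later one with
  the same power of the last variable, so the later remainder can be reduced further.\<close>

lemma homogeneous_sequence_dependent:
  fixes F :: "nat \<Rightarrow> rpoly"
  assumes F: "\<And>k. F k \<in> homogeneous (Suc n) (k + d)"
    and bound: "\<And>k a. a \<in> Poly_Mapping.keys (F k) \<Longrightarrow> Poly_Mapping.lookup a n \<le> d"
  shows "\<exists>k. F k \<in> homogeneous_combinations n F k"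
proof (rule ccontr)
  assume indep: "\<nexists>k. F k \<in> homogeneous_combinations n F k"
  define N where "N = homogeneous_combinations n F"
  have indep: "F k \<notin> N k" for k using indep by (simp add: N_def)
  have N_keys: "w \<in> homogeneous (Suc n) (k + d) \<and> (\<forall>a\<in>Poly_Mapping.keys w. Poly_Mapping.lookup a n \<le> d)"
    if w: "w \<in> N k" for k w
  proof -
    obtain b where b: "\<forall>i<k. b i \<in> homogeneous n (k - i)" "w = (\<Sum>i<k. b i * F i)"
      using w unfolding N_def homogeneous_combinations_def by blast
    have bS: "b i \<in> homogeneous (Suc n) (k - i) \<and> (\<forall>a\<in>Poly_Mapping.keys (b i). Poly_Mapping.lookup a n = 0)"
      if "i < k" for i
    proof -
      have "Poly_Mapping.keys a \<subseteq> {..<Suc n} \<and> Poly_Mapping.lookup a n = 0 \<and> exponent_sum (Suc n) a = k - i"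
        if a: "a \<in> Poly_Mapping.keys (b i)" for a
      proof -
        have *: "Poly_Mapping.keys a \<subseteq> {..<n}" "exponent_sum n a = k - i"
          using b(1) \<open>i < k\<close> a unfolding homogeneous_def by auto
        then have "n \<notin> Poly_Mapping.keys a" by auto
        then have "Poly_Mapping.lookup a n = 0" by (simp add: not_in_keys_iff_lookup_eq_zero)
        with * show ?thesis by (auto simp: exponent_sum_Suc)
      qed
      then show ?thesis unfolding homogeneous_def by blast
    qed
    have "b i * F i \<in> homogeneous (Suc n) (k + d)" if "i < k" for i
      using homogeneous_mult[OF conjunct1[OF bS[OF that]] F[of i]] that by simp
    then have "w \<in> homogeneous (Suc n) (k + d)" unfolding b(2) by (intro homogeneous_sum) auto
    moreover have "Poly_Mapping.lookup c n \<le> d" if c: "c \<in> Poly_Mapping.keys w" for c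
    proof -
      obtain i where "i < k" "c \<in> Poly_Mapping.keys (b i * F i)"
        using c keys_sum[of "\<lambda>i. b i * F i" "{..<k}"] unfolding b(2) by auto
      then obtain a a' where "a \<in> Poly_Mapping.keys (b i)" "a' \<in> Poly_Mapping.keys (F i)" "c = a + a'"
        by (auto elim: keys_mult_elim)
      then show ?thesis using bS[OF \<open>i < k\<close>] bound[of a' i] by (simp add: lookup_add)
    qed
    ultimately show ?thesis by blast
  qed
  have rem_keys: "e \<in> homogeneous (Suc n) (k + d) \<and> (\<forall>a\<in>Poly_Mapping.keys e. Poly_Mapping.lookup a n \<le> d) \<and> e \<noteq> 0"
    if e: "F k - e \<in> N k" for k e
  proof -
    have "e \<in> homogeneous (Suc n) (k + d)"
      using homogeneous_diff[OF F[of k] conjunct1[OF N_keys[OF e]]] by simp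
    moreover have "Poly_Mapping.lookup a n \<le> d" if "a \<in> Poly_Mapping.keys e" for a
      using keys_rpoly_diff[of "F k" "F k - e"] that N_keys[OF e] bound[of a k] by auto
    moreover have "e \<noteq> 0" using e indep[of k] by auto
    ultimately show ?thesis by blast
  qed
  \<comment> \<open>\<open>E k\<close> is a remainder of \<open>F k\<close> modulo its predecessors whose leading exponent is least.\<close>
  have "\<exists>e. F k - e \<in> N k \<and> (\<forall>e'. F k - e' \<in> N k \<longrightarrow> \<not> lead_exp e' < lead_exp e)" for k
  proof -
    define Z where "Z = lead_exp ` {e. F k - e \<in> N k}"
    have Zkeys: "Poly_Mapping.keys z \<subseteq> {..<Suc n}" if "z \<in> Z" for z
      using that rem_keys[of k] lead_exp_in unfolding Z_def homogeneous_def by blast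
    have "F k - F k \<in> N k" using homogeneous_combinations_0 by (simp add: N_def)
    then have "lead_exp (F k) \<in> Z" unfolding Z_def by blast
    then obtain z where z: "z \<in> Z"
      "\<And>y. (y, z) \<in> {(a, b). a < b \<and> Poly_Mapping.keys a \<subseteq> {..<Suc n} \<and> Poly_Mapping.keys b \<subseteq> {..<Suc n}} \<Longrightarrow> y \<notin> Z"
      by (rule wfE_min[OF wf_lex]) blast
    have "\<not> y < z" if "y \<in> Z" for y using z(2)[of y] that Zkeys[OF that] Zkeys[OF z(1)] by auto
    with z(1) show ?thesis unfolding Z_def by auto
  qed
  then obtain E where E: "\<And>k. F k - E k \<in> N k"
    and min: "\<And>k e'. F k - e' \<in> N k \<Longrightarrow> \<not> lead_exp e' < lead_exp (E k)"
    by metis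
  define L where "L k = lead_exp (E k)" for k
  have L: "Poly_Mapping.keys (L k) \<subseteq> {..<Suc n}" "exponent_sum (Suc n) (L k) = k + d"
    "Poly_Mapping.lookup (L k) n \<le> d" for k
    using rem_keys[OF E[of k]] lead_exp_in[of "E k"] unfolding L_def homogeneous_def by blast+
  \<comment> \<open>The additional coordinate \<open>d - e\<close> makes Dickson's lemma force equal exponents \<open>e\<close> of the last variable.\<close>
  obtain i j where ij: "i < j"
    "\<And>v. v < n + 2 \<Longrightarrow> (if v \<le> n then Poly_Mapping.lookup (L i) v else d - Poly_Mapping.lookup (L i) n)
      \<le> (if v \<le> n then Poly_Mapping.lookup (L j) v else d - Poly_Mapping.lookup (L j) n)"
    using Dickson[of "n + 2" "\<lambda>k v. if v \<le> n then Poly_Mapping.lookup (L k) v else d - Poly_Mapping.lookup (L k) n"]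
    by blast
  have le: "Poly_Mapping.lookup (L i) v \<le> Poly_Mapping.lookup (L j) v" for v
  proof (cases "v \<le> n")
    case False
    then have "v \<notin> Poly_Mapping.keys (L i)" using L(1)[of i] by auto
    then show ?thesis by (simp add: not_in_keys_iff_lookup_eq_zero)
  qed (use ij(2)[of v] in simp)
  have eq: "Poly_Mapping.lookup (L i) n = Poly_Mapping.lookup (L j) n"
    using le[of n] ij(2)[of "Suc n"] L(3)[of i] L(3)[of j] by simp
  define b where "b = L j - L i"
  have Lb: "L j = b + L i"
    by (rule poly_mapping_eqI) (use le in \<open>simp add: b_def lookup_add minus_poly_mapping.rep_eq\<close>)
  have b: "Poly_Mapping.lookup b n = 0" using eq unfolding Lb by (simp add: lookup_add)
  have "Poly_Mapping.keys b \<subseteq> {..<Suc n}" using L(1)[of j] unfolding Lb keys_exponent_add by blast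
  then have "Poly_Mapping.keys b \<subseteq> {..<n}"
    using b by (auto simp: lessThan_Suc)
  moreover have "exponent_sum n b = j - i"
    using L(2)[of j] L(2)[of i] ij(1) b exponent_sum_Suc[of n b] exponent_sum_add[of "Suc n" b "L i"]
    unfolding Lb by linarith
  ultimately have p: "Poly_Mapping.single b c \<in> homogeneous n (j - i)" for c by (rule homogeneous_single)
  have "E j \<noteq> 0" "E i \<noteq> 0" using rem_keys[OF E] by blast+
  then obtain c where c: "E j - Poly_Mapping.single b c * E i = 0 \<or>
      lead_exp (E j - Poly_Mapping.single b c * E i) < lead_exp (E j)"
    by (rule lead_exp_reduce) (use Lb in \<open>simp add: L_def\<close>)
  define D where "D = E j - Poly_Mapping.single b c * E i"
  have "F j - D = (F j - E j) + (Poly_Mapping.single b c * F i - Poly_Mapping.single b c * (F i - E i))"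
    by (simp add: D_def algebra_simps)
  also have "\<dots> \<in> N j"
    unfolding N_def
  proof (rule homogeneous_combinations_add[OF _ homogeneous_combinations_diff])
    show "F j - E j \<in> homogeneous_combinations n F j" using E[of j] by (simp add: N_def)
    show "Poly_Mapping.single b c * F i \<in> homogeneous_combinations n F j"
      by (rule homogeneous_combinations_generator[OF ij(1) p])
    show "Poly_Mapping.single b c * (F i - E i) \<in> homogeneous_combinations n F j"
      using E[of i] by (intro homogeneous_combinations_mult[OF ij(1) p]) (simp add: N_def)
  qed
  finally have D: "F j - D \<in> N j" .
  then have "D \<noteq> 0" using rem_keys[of j D] by blast
  with c have "lead_exp D < lead_exp (E j)" unfolding D_def[symmetric] by simp
  with min[OF D] show False by simp
qed

section \<open>Moments of a nonnegative variable with rational transform\<close>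

text \<open>The Taylor remainder of \<open>exp (- y)\<close>, with the sign that makes it nonnegative for \<open>y \<ge> 0\<close>.\<close>

definition exp_remainder :: "nat \<Rightarrow> real \<Rightarrow> real" where
  "exp_remainder k y = (-1) ^ k * (exp (- y) - (\<Sum>i<k. (- y) ^ i / fact i))"

lemma exp_remainder_nonneg: "exp_remainder k y \<ge> 0" if "y \<ge> 0"
proof -
  obtain t where "exp (- y) = (\<Sum>i<k. (- y) ^ i / fact i) + exp t / fact k * (- y) ^ k"
    using Maclaurin_exp_le by blast
  then have "exp_remainder k y = exp t / fact k * ((-1) ^ k * (- y) ^ k)"
    by (simp add: exp_remainder_def)
  also have "(-1) ^ k * (- y) ^ k = y ^ k" by (simp flip: power_mult_distrib)
  finally show ?thesis using that by simp
qed

lemma exp_remainder_add_Suc: "exp_remainder k y + exp_remainder (Suc k) y = y ^ k / fact k"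
proof -
  have "exp_remainder k y + exp_remainder (Suc k) y = ((-1) ^ k * (- y) ^ k) / fact k"
    by (simp add: exp_remainder_def algebra_simps)
  also have "(-1) ^ k * (- y) ^ k = y ^ k" by (simp flip: power_mult_distrib)
  finally show ?thesis .
qed

lemma exp_remainder_le: "exp_remainder k y \<le> y ^ k / fact k" if "y \<ge> 0"
  using exp_remainder_add_Suc[of k y] exp_remainder_nonneg[OF that, of "Suc k"] by linarith

lemma exp_remainder_Suc_le: "exp_remainder (Suc k) y \<le> y ^ k / fact k" if "y \<ge> 0"
  using exp_remainder_add_Suc[of k y] exp_remainder_nonneg[OF that, of k] by linarith

lemma exp_remainder_measurable [measurable]: "exp_remainder k \<in> borel_measurable borel"
  unfolding exp_remainder_def by measurable

definition recip :: "nat \<Rightarrow> real" where "recip N = 1 / real (Suc N)"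

lemma recip_pos: "recip N > 0" by (simp add: recip_def)

lemma recip_le_1: "recip N \<le> 1" by (simp add: recip_def)

lemma recip_tendsto: "recip \<longlonglongrightarrow> 0"
  unfolding recip_def by (rule LIMSEQ_Suc[OF lim_1_over_n])

lemma poly_recip_tendsto: "(\<lambda>N. poly p (recip N)) \<longlonglongrightarrow> poly p 0"
  by (rule tendsto_poly[OF recip_tendsto])

lemma eventually_poly_recip_nonzero:
  assumes "(p :: real poly) \<noteq> 0"
  shows "eventually (\<lambda>N. poly p (recip N) \<noteq> 0) sequentially"
proof -
  have "\<not> 0 islimpt {x. poly p x = 0}"
    using poly_roots_finite[OF assms] by (simp add: islimpt_finite)
  then have "eventually (\<lambda>x. poly p x \<noteq> 0) (at 0)" by (simp add: islimpt_iff_eventually)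
  moreover have "filterlim recip (at 0) sequentially"
    using recip_tendsto recip_pos by (simp add: filterlim_at less_imp_neq[THEN not_sym] eventually_mono)
  ultimately show ?thesis by (rule eventually_compose_filterlim)
qed

lemma poly_extract_power:
  assumes "(p :: real poly) \<noteq> 0"
  obtains e p1 where "\<And>x. poly p x = x ^ e * poly p1 x" "poly p1 0 \<noteq> 0"
proof -
  obtain p1 where p1: "p = [:- 0, 1:] ^ order 0 p * p1" "\<not> [:- 0, 1:] dvd p1"
    using order_decomp[OF assms, of 0] by blast
  have "poly p x = x ^ order 0 p * poly p1 x" for x
    using arg_cong[OF p1(1), of "\<lambda>p. poly p x"] by (simp add: poly_power)
  moreover have "poly p1 0 \<noteq> 0"
    using p1(2) poly_eq_0_iff_dvd[of p1 0] by simp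
  ultimately show thesis by (rule that)
qed

text \<open>A rational function tends to 0 at the rate of an integral power, so \<open>o(x\<^sup>k)\<close> improves to
  \<open>O(x\<^sup>k\<^sup>+\<^sup>1)\<close>.\<close>

lemma rational_decay_gap:
  fixes r :: "nat \<Rightarrow> real" and q g :: "real poly"
  assumes "q \<noteq> 0" and eq: "\<And>N. r N * poly q (recip N) = poly g (recip N)"
    and lim: "(\<lambda>N. r N / recip N ^ k) \<longlonglongrightarrow> 0"
  obtains C where "C \<ge> 0" "eventually (\<lambda>N. \<bar>r N\<bar> \<le> C * recip N ^ Suc k) sequentially"
proof (cases "g = 0")
  case True
  have "eventually (\<lambda>N. \<bar>r N\<bar> \<le> 0 * recip N ^ Suc k) sequentially"
    using eventually_poly_recip_nonzero[OF assms(1)] by eventually_elim (use eq True in auto)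
  then show thesis by (rule that[of 0, rotated]) simp
next
  case False
  obtain a g1 where g: "\<And>x. poly g x = x ^ a * poly g1 x" "poly g1 0 \<noteq> 0"
    using poly_extract_power[OF False] by blast
  obtain e q1 where q: "\<And>x. poly q x = x ^ e * poly q1 x" "poly q1 0 \<noteq> 0"
    using poly_extract_power[OF assms(1)] by blast
  have eq: "r N * recip N ^ e * poly q1 (recip N) = recip N ^ a * poly g1 (recip N)" for N
    using eq[of N] by (simp add: g q mult_ac)
  have "a \<ge> Suc (e + k)"
  proof (rule ccontr)
    assume "\<not> ?thesis"
    then have a: "a \<le> e + k" by simp
    have "poly g1 (recip N) = r N / recip N ^ k * (recip N ^ (e + k - a) * poly q1 (recip N))" for N
    proof -
      have "recip N ^ a * poly g1 (recip N) = r N / recip N ^ k * recip N ^ (e + k) * poly q1 (recip N)"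
        using recip_pos[of N] by (simp add: eq[symmetric] power_add)
      also have "recip N ^ (e + k) = recip N ^ a * recip N ^ (e + k - a)"
        using a by (simp flip: power_add)
      finally show ?thesis using recip_pos[of N] by (simp add: field_simps)
    qed
    moreover have "(\<lambda>N. r N / recip N ^ k * (recip N ^ (e + k - a) * poly q1 (recip N))) \<longlonglongrightarrow> 0 * (0 ^ (e + k - a) * poly q1 0)"
      by (intro tendsto_mult lim tendsto_power recip_tendsto poly_recip_tendsto)
    ultimately have "(\<lambda>N. poly g1 (recip N)) \<longlonglongrightarrow> 0" by simp
    then show False using LIMSEQ_unique[OF poly_recip_tendsto[of g1]] g(2) by auto
  qed
  define b where "b = a - Suc (e + k)"
  have a: "a = e + Suc k + b" using \<open>a \<ge> _\<close> by (simp add: b_def)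
  have "(\<lambda>N. recip N ^ b * poly g1 (recip N) / poly q1 (recip N)) \<longlonglongrightarrow> 0 ^ b * poly g1 0 / poly q1 0"
    using q(2) by (intro tendsto_intros recip_tendsto poly_recip_tendsto)
  then have "Bseq (\<lambda>N. recip N ^ b * poly g1 (recip N) / poly q1 (recip N))"
    by (intro convergent_imp_Bseq convergentI)
  then obtain C where C: "C > 0" "\<And>N. \<bar>recip N ^ b * poly g1 (recip N) / poly q1 (recip N)\<bar> \<le> C"
    by (auto simp: Bseq_def)
  have "q1 \<noteq> 0" using q(2) by auto
  from eventually_poly_recip_nonzero[OF this]
  have "eventually (\<lambda>N. \<bar>r N\<bar> \<le> C * recip N ^ Suc k) sequentially"
  proof eventually_elim
    case (elim N)
    have "r N = recip N ^ Suc k * (recip N ^ b * poly g1 (recip N) / poly q1 (recip N))"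
      using eq[of N] elim recip_pos[of N] unfolding a power_add by (simp add: field_simps)
    then have "\<bar>r N\<bar> = recip N ^ Suc k * \<bar>recip N ^ b * poly g1 (recip N) / poly q1 (recip N)\<bar>"
      using recip_pos[of N] by (simp add: abs_mult)
    also have "\<dots> \<le> recip N ^ Suc k * C"
      using C(2) recip_pos[of N] by (intro mult_left_mono) auto
    finally show ?case by (simp add: mult.commute)
  qed
  with C show thesis by (intro that[of C]) auto
qed

text \<open>Induction on \<open>k\<close>: if the moments up to order \<open>k\<close> are finite, the expected Taylor remainder of
  \<open>exp (- x Y)\<close> beyond order \<open>k\<close> is a rational function of \<open>x\<close>. It is \<open>o(x\<^sup>k)\<close> by dominated
  convergence, hence \<open>O(x\<^sup>k\<^sup>+\<^sup>1)\<close>, and Fatou's lemma then bounds the next moment.\<close>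

lemma (in prob_space) moments_finite_of_rational_transform:
  fixes Y :: "'a \<Rightarrow> real" and p q :: "real poly"
  assumes Y [measurable]: "Y \<in> borel_measurable M" and nonneg: "AE w in M. 0 \<le> Y w"
    and "q \<noteq> 0"
    and rat: "\<And>x. x > 0 \<Longrightarrow> expectation (\<lambda>w. exp (- (x * Y w))) * poly q x = poly p x"
  shows "integrable M (\<lambda>w. Y w ^ k)"
proof -
  have "\<forall>i\<le>k. integrable M (\<lambda>w. Y w ^ i)"
  proof (induction k)
    case 0
    show ?case by simp
  next
    case (Suc k)
    define m where "m i = expectation (\<lambda>w. Y w ^ i)" for i
    define T :: "real poly" where "T = (\<Sum>i<Suc k. monom ((-1) ^ i * m i / fact i) i)"
    define r where "r N = expectation (\<lambda>w. exp_remainder (Suc k) (recip N * Y w))" for N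
    have exp_int: "integrable M (\<lambda>w. exp (- (recip N * Y w)))" for N
      by (rule integrable_const_bound[of _ 1])
        (use nonneg recip_pos[of N] in \<open>auto elim!: eventually_mono\<close>)
    have rem_int: "integrable M (\<lambda>w. exp_remainder (Suc k) (recip N * Y w))" for N
      unfolding exp_remainder_def using Suc
      by (intro integrable_mult_right Bochner_Integration.integrable_diff exp_int
          Bochner_Integration.integrable_sum) (auto simp: power_mult_distrib power_minus[of "_ * _"])
    have r: "r N = (-1) ^ Suc k * (expectation (\<lambda>w. exp (- (recip N * Y w))) - poly T (recip N))" for N
    proof -
      have tint: "integrable M (\<lambda>w. (- (recip N * Y w)) ^ i / fact i)" if "i < Suc k" for i
        using Suc that by (simp add: power_mult_distrib power_minus[of "_ * _"])
      have "r N = (-1) ^ Suc k * expectation (\<lambda>w. exp (- (recip N * Y w))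
          - (\<Sum>i<Suc k. (- (recip N * Y w)) ^ i / fact i))"
        unfolding r_def exp_remainder_def by (rule integral_mult_right_zero)
      also have "expectation (\<lambda>w. exp (- (recip N * Y w)) - (\<Sum>i<Suc k. (- (recip N * Y w)) ^ i / fact i))
          = expectation (\<lambda>w. exp (- (recip N * Y w)))
            - expectation (\<lambda>w. \<Sum>i<Suc k. (- (recip N * Y w)) ^ i / fact i)"
        using tint by (intro Bochner_Integration.integral_diff exp_int Bochner_Integration.integrable_sum) simp
      also have "expectation (\<lambda>w. \<Sum>i<Suc k. (- (recip N * Y w)) ^ i / fact i)
          = (\<Sum>i<Suc k. expectation (\<lambda>w. (- (recip N * Y w)) ^ i / fact i))"
        using tint by (intro Bochner_Integration.integral_sum) simp
      also have "(\<Sum>i<Suc k. expectation (\<lambda>w. (- (recip N * Y w)) ^ i / fact i)) = poly T (recip N)"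
        unfolding T_def poly_sum poly_monom
        by (intro sum.cong refl) (simp add: power_mult_distrib power_minus[of "_ * _"] m_def)
      finally show ?thesis .
    qed
    define g where "g = Polynomial.smult ((-1) ^ Suc k) (p - q * T)"
    have rg: "r N * poly q (recip N) = poly g (recip N)" for N
      using rat[OF recip_pos[of N]] by (simp add: r g_def algebra_simps)
    have bnd: "AE w in M. 0 \<le> exp_remainder (Suc k) (recip N * Y w) / recip N ^ Suc k \<and>
        exp_remainder (Suc k) (recip N * Y w) / recip N ^ k \<le> Y w ^ k / fact k" for N
      using nonneg
    proof eventually_elim
      case (elim w)
      then have *: "0 \<le> recip N * Y w" using recip_pos[of N] by simp
      show ?case
        using exp_remainder_Suc_le[OF *, of k] exp_remainder_nonneg[OF *, of "Suc k"] recip_pos[of N]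
        by (simp add: power_mult_distrib field_simps)
    qed
    have lim1: "(\<lambda>N. exp_remainder j (recip N * y) / recip N ^ j) \<longlonglongrightarrow> y ^ j / fact j" if "y \<ge> 0" for y j
    proof (rule tendsto_sandwich[OF _ _ _ tendsto_const])
      show "\<forall>\<^sub>F N in sequentially. exp_remainder j (recip N * y) / recip N ^ j \<le> y ^ j / fact j"
      proof (intro always_eventually allI)
        fix N have *: "0 \<le> recip N * y" using recip_pos[of N] that by simp
        show "exp_remainder j (recip N * y) / recip N ^ j \<le> y ^ j / fact j"
          using exp_remainder_le[OF *, of j] recip_pos[of N] by (simp add: power_mult_distrib field_simps)
      qed
      show "\<forall>\<^sub>F N in sequentially. y ^ j / fact j - recip N * (y ^ Suc j / fact (Suc j))
          \<le> exp_remainder j (recip N * y) / recip N ^ j"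
      proof (intro always_eventually allI)
        fix N have *: "0 \<le> recip N * y" using recip_pos[of N] that by simp
        have "(recip N * y) ^ j / fact j - (recip N * y) ^ Suc j / fact (Suc j) \<le> exp_remainder j (recip N * y)"
          using exp_remainder_le[OF *, of "Suc j"] exp_remainder_add_Suc[of j "recip N * y"] by linarith
        then have "((recip N * y) ^ j / fact j - (recip N * y) ^ Suc j / fact (Suc j)) / recip N ^ j
            \<le> exp_remainder j (recip N * y) / recip N ^ j"
          using recip_pos[of N] by (intro divide_right_mono) auto
        moreover have "((recip N * y) ^ j / fact j - (recip N * y) ^ Suc j / fact (Suc j)) / recip N ^ j
            = y ^ j / fact j - recip N * (y ^ Suc j / fact (Suc j))"
          using recip_pos[of N] by (simp add: power_mult_distrib diff_divide_distrib)
        ultimately show "y ^ j / fact j - recip N * (y ^ Suc j / fact (Suc j))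
            \<le> exp_remainder j (recip N * y) / recip N ^ j" by simp
      qed
      have "(\<lambda>N. y ^ j / fact j - recip N * (y ^ Suc j / fact (Suc j))) \<longlonglongrightarrow> y ^ j / fact j - 0 * (y ^ Suc j / fact (Suc j))"
        by (intro tendsto_intros recip_tendsto)
      then show "(\<lambda>N. y ^ j / fact j - recip N * (y ^ Suc j / fact (Suc j))) \<longlonglongrightarrow> y ^ j / fact j" by simp
    qed
    have lim0: "(\<lambda>N. exp_remainder (Suc k) (recip N * y) / recip N ^ k) \<longlonglongrightarrow> 0" if "y \<ge> 0" for y
    proof -
      have "(\<lambda>N. exp_remainder (Suc k) (recip N * y) / recip N ^ Suc k * recip N) \<longlonglongrightarrow> y ^ Suc k / fact (Suc k) * 0"
        by (intro tendsto_mult lim1 that recip_tendsto)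
      moreover have "exp_remainder (Suc k) (recip N * y) / recip N ^ Suc k * recip N
          = exp_remainder (Suc k) (recip N * y) / recip N ^ k" for N
        using recip_pos[of N] by simp
      ultimately show ?thesis by simp
    qed
    have "(\<lambda>N. expectation (\<lambda>w. exp_remainder (Suc k) (recip N * Y w) / recip N ^ k)) \<longlonglongrightarrow> expectation (\<lambda>w. 0)"
    proof (rule integral_dominated_convergence)
      show "integrable M (\<lambda>w. Y w ^ k / fact k)" using Suc by simp
      show "AE w in M. (\<lambda>N. exp_remainder (Suc k) (recip N * Y w) / recip N ^ k) \<longlonglongrightarrow> 0"
        using nonneg by eventually_elim (rule lim0)
      show "AE w in M. norm (exp_remainder (Suc k) (recip N * Y w) / recip N ^ k) \<le> Y w ^ k / fact k" for N
        using bnd[of N] nonneg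
      proof eventually_elim
        case (elim w)
        then have "0 \<le> exp_remainder (Suc k) (recip N * Y w)"
          using recip_pos[of N] by (intro exp_remainder_nonneg) simp
        with elim show ?case using recip_pos[of N] by simp
      qed
    qed simp_all
    then have "(\<lambda>N. r N / recip N ^ k) \<longlonglongrightarrow> 0" by (simp add: r_def)
    then obtain C where C: "C \<ge> 0" "eventually (\<lambda>N. \<bar>r N\<bar> \<le> C * recip N ^ Suc k) sequentially"
      by (rule rational_decay_gap[OF \<open>q \<noteq> 0\<close> rg])
    define u where "u N w = ennreal (exp_remainder (Suc k) (recip N * Y w) / recip N ^ Suc k)" for N w
    have u_int: "(\<integral>\<^sup>+ w. u N w \<partial>M) = ennreal (r N / recip N ^ Suc k)" for N
    proof -
      have "(\<integral>\<^sup>+ w. u N w \<partial>M) = ennreal (expectation (\<lambda>w. exp_remainder (Suc k) (recip N * Y w) / recip N ^ Suc k))"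
        unfolding u_def
      proof (rule nn_integral_eq_integral)
        show "integrable M (\<lambda>w. exp_remainder (Suc k) (recip N * Y w) / recip N ^ Suc k)"
          using rem_int[of N] by simp
        show "AE w in M. 0 \<le> exp_remainder (Suc k) (recip N * Y w) / recip N ^ Suc k"
          using bnd[of N] by (rule eventually_mono) blast
      qed
      then show ?thesis by (simp add: r_def)
    qed
    have "(\<integral>\<^sup>+ w. ennreal (Y w ^ Suc k / fact (Suc k)) \<partial>M) = (\<integral>\<^sup>+ w. liminf (\<lambda>N. u N w) \<partial>M)"
    proof (rule nn_integral_cong_AE, use nonneg in eventually_elim)
      fix w assume "0 \<le> Y w"
      then have "(\<lambda>N. u N w) \<longlonglongrightarrow> ennreal (Y w ^ Suc k / fact (Suc k))"
        unfolding u_def by (intro tendsto_ennrealI lim1)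
      then show "ennreal (Y w ^ Suc k / fact (Suc k)) = liminf (\<lambda>N. u N w)"
        by (simp add: lim_imp_Liminf)
    qed
    also have "\<dots> \<le> liminf (\<lambda>N. \<integral>\<^sup>+ w. u N w \<partial>M)"
      by (rule nn_integral_liminf) (simp add: u_def)
    also have "\<dots> \<le> ennreal C"
    proof (rule Liminf_le)
      show "\<forall>\<^sub>F N in sequentially. (\<integral>\<^sup>+ w. u N w \<partial>M) \<le> ennreal C"
        using C(2)
      proof eventually_elim
        case (elim N)
        then have "r N / recip N ^ Suc k \<le> C" using recip_pos[of N] by (simp add: pos_divide_le_eq)
        then show ?case unfolding u_int by (rule ennreal_leI)
      qed
    qed simp
    finally have fin: "(\<integral>\<^sup>+ w. ennreal (Y w ^ Suc k / fact (Suc k)) \<partial>M) < \<infinity>"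
      by (rule le_less_trans) simp
    have "integrable M (\<lambda>w. Y w ^ Suc k / fact (Suc k))"
    proof (rule integrableI_bounded)
      have "(\<integral>\<^sup>+ w. ennreal (norm (Y w ^ Suc k / fact (Suc k))) \<partial>M) = (\<integral>\<^sup>+ w. ennreal (Y w ^ Suc k / fact (Suc k)) \<partial>M)"
        by (rule nn_integral_cong_AE, use nonneg in eventually_elim) simp
      with fin show "(\<integral>\<^sup>+ w. ennreal (norm (Y w ^ Suc k / fact (Suc k))) \<partial>M) < \<infinity>" by simp
    qed measurable
    then have "integrable M (\<lambda>w. fact (Suc k) * (Y w ^ Suc k / fact (Suc k)))"
      by (rule integrable_mult_right)
    then have "integrable M (\<lambda>w. Y w ^ Suc k)" by simp
    with Suc show ?case by (auto simp: le_Suc_eq)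
  qed
  then show ?thesis by simp
qed

section \<open>Restriction to lines and rays\<close>

definition line_poly :: "nat \<Rightarrow> real Matrix.vec \<Rightarrow> real Matrix.vec \<Rightarrow> rpoly \<Rightarrow> real poly" where
  "line_poly n s v P = (\<Sum>a\<in>Poly_Mapping.keys P.
     Polynomial.smult (Poly_Mapping.lookup P a) (\<Prod>j<n. [:s $ j, v $ j:] ^ Poly_Mapping.lookup a j))"

lemma poly_line_poly:
  assumes "s \<in> carrier_vec n" "v \<in> carrier_vec n"
  shows "poly (line_poly n s v P) x = poly_val n P (s + x \<cdot>\<^sub>v v)"
  unfolding line_poly_def poly_val_def poly_sum poly_smult poly_prod poly_power
  by (intro sum.cong refl arg_cong2[where f = "(*)"] prod.cong arg_cong2[where f = "(^)"])
    (use assms in \<open>auto simp: mult.commute\<close>)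

definition ray_poly :: "nat \<Rightarrow> real Matrix.vec \<Rightarrow> rpoly \<Rightarrow> real poly" where
  "ray_poly n v P = (\<Sum>a\<in>Poly_Mapping.keys P.
     Polynomial.monom (Poly_Mapping.lookup P a * monomial_val n a v) (exponent_sum n a))"

lemma poly_ray_poly:
  assumes "v \<in> carrier_vec n"
  shows "poly (ray_poly n v P) x = poly_val n P (x \<cdot>\<^sub>v v)"
proof -
  have "monomial_val n a (x \<cdot>\<^sub>v v) = monomial_val n a v * x ^ exponent_sum n a" for a
  proof -
    have "monomial_val n a (x \<cdot>\<^sub>v v) = (\<Prod>j<n. v $ j ^ Poly_Mapping.lookup a j * x ^ Poly_Mapping.lookup a j)"
      unfolding monomial_val_def using assms by (intro prod.cong) (auto simp: power_mult_distrib)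
    then show ?thesis by (simp add: prod.distrib monomial_val_def exponent_sum_def power_sum)
  qed
  then show ?thesis
    by (simp add: ray_poly_def poly_sum poly_monom poly_val_def monomial_val_def[symmetric] mult.assoc)
qed

lemma coeff_ray_poly:
  "Polynomial.coeff (ray_poly n v P) m =
     (\<Sum>a\<in>{a\<in>Poly_Mapping.keys P. exponent_sum n a = m}. Poly_Mapping.lookup P a * monomial_val n a v)"
  by (simp add: ray_poly_def coeff_sum sum.inter_filter)

lemma exists_coeff_ray_nonzero:
  assumes "P \<in> polys n" "a0 \<in> Poly_Mapping.keys P"
  obtains v where "v \<in> carrier_vec n" "\<And>j. j < n \<Longrightarrow> v $ j > 0"
    "Polynomial.coeff (ray_poly n v P) (exponent_sum n a0) \<noteq> 0"
proof -
  define A where "A = {a\<in>Poly_Mapping.keys P. exponent_sum n a = exponent_sum n a0}"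
  have "\<exists>s::nat \<Rightarrow> real. (\<forall>j. s j > (\<lambda>_. 0) j) \<and>
      (\<Sum>a\<in>A. Poly_Mapping.lookup P a * (\<Prod>j<n. s j ^ Poly_Mapping.lookup a j)) \<noteq> 0"
  proof (rule exists_nonzero_value_large)
    show "finite A" "a0 \<in> A" "Poly_Mapping.lookup P a0 \<noteq> 0"
      using assms(2) by (auto simp: A_def in_keys_iff)
    show "a = b" if "a \<in> A" "b \<in> A" "\<And>j. j < n \<Longrightarrow> Poly_Mapping.lookup a j = Poly_Mapping.lookup b j" for a b
      by (rule exponents_determined[OF assms(1)]) (use that in \<open>auto simp: A_def\<close>)
  qed
  then obtain s :: "nat \<Rightarrow> real" where s: "\<And>j. s j > 0"
    "(\<Sum>a\<in>A. Poly_Mapping.lookup P a * (\<Prod>j<n. s j ^ Poly_Mapping.lookup a j)) \<noteq> 0" by blast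
  have "Polynomial.coeff (ray_poly n (Matrix.vec n s) P) (exponent_sum n a0) =
      (\<Sum>a\<in>A. Poly_Mapping.lookup P a * (\<Prod>j<n. s j ^ Poly_Mapping.lookup a j))"
    unfolding coeff_ray_poly A_def monomial_val_def
    by (intro sum.cong refl arg_cong2[where f = "(*)"] prod.cong) simp
  with s show thesis by (intro that[of "Matrix.vec n s"]) auto
qed

text \<open>Divide by \<open>x\<close> repeatedly: the constant term is the limit at 0.\<close>

lemma coeff_zero_of_small:
  fixes r :: "real poly"
  assumes "\<And>x. 0 < x \<Longrightarrow> x \<le> 1 \<Longrightarrow> \<bar>poly r x\<bar> \<le> C * x ^ Suc k" "m \<le> k"
  shows "Polynomial.coeff r m = 0"
  using assms
proof (induction k arbitrary: r m)
  case (0 r m)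
  have "(\<lambda>N. C * recip N ^ Suc 0) \<longlonglongrightarrow> C * 0 ^ Suc 0"
    by (intro tendsto_intros recip_tendsto)
  then have "(\<lambda>N. poly r (recip N)) \<longlonglongrightarrow> 0"
    by (intro Lim_null_comparison[of "\<lambda>N. poly r (recip N)" "\<lambda>N. C * recip N ^ Suc 0"])
      (auto intro!: always_eventually simp: recip_pos recip_le_1 0(1)[simplified])
  then have "poly r 0 = 0" using LIMSEQ_unique[OF poly_recip_tendsto[of r]] by auto
  with 0 show ?case by (simp add: poly_0_coeff_0)
next
  case (Suc k r m)
  have "Polynomial.coeff r 0 = 0"
  proof -
    have "\<bar>poly r x\<bar> \<le> \<bar>C\<bar> * x ^ Suc 0" if "0 < x" "x \<le> 1" for x
    proof -
      have "\<bar>poly r x\<bar> \<le> C * x ^ Suc (Suc k)" by (rule Suc.prems(1)[OF that])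
      also have "\<dots> \<le> \<bar>C\<bar> * x ^ Suc 0"
        using that by (intro mult_mono power_decreasing) auto
      finally show ?thesis .
    qed
    then have lim: "(\<lambda>N. poly r (recip N)) \<longlonglongrightarrow> 0"
      by (intro Lim_null_comparison[of "\<lambda>N. poly r (recip N)" "\<lambda>N. \<bar>C\<bar> * recip N"])
        (auto intro!: always_eventually tendsto_mult_right_zero recip_tendsto simp: recip_pos recip_le_1)
    then have "poly r 0 = 0" using LIMSEQ_unique[OF poly_recip_tendsto[of r]] by auto
    then show ?thesis by (simp add: poly_0_coeff_0)
  qed
  then obtain r1 where r1: "r = pCons 0 r1" by (cases r) auto
  show ?case
  proof (cases m)
    case 0
    with \<open>Polynomial.coeff r 0 = 0\<close> show ?thesis by simp
  next
    case (Suc m')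
    have "\<bar>poly r1 x\<bar> \<le> C * x ^ Suc k" if x: "0 < x" "x \<le> 1" for x
    proof -
      have "x * \<bar>poly r1 x\<bar> \<le> x * (C * x ^ Suc k)"
        using Suc.prems(1)[OF x] x by (simp add: r1 abs_mult mult_ac)
      then show ?thesis using x by simp
    qed
    then show ?thesis using Suc.IH[of r1 m'] Suc.prems(2) by (simp add: r1 Suc)
  qed
qed

section \<open>Laplace transforms on the orthant\<close>

locale nonneg_law =
  fixes n :: nat and \<mu> :: "(nat \<Rightarrow> real) measure"
  assumes law: "\<mu> \<in> nonneg_laws n"
begin

sublocale prob_space \<mu> using law by (simp add: nonneg_laws_def)

lemma sets_law [measurable_cong]: "sets \<mu> = sets (Pi\<^sub>M {..<n} (\<lambda>_. borel))"
  using law by (simp add: nonneg_laws_def)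

lemma AE_nonneg: "AE x in \<mu>. \<forall>j<n. 0 \<le> x j"
  using law by (simp add: nonneg_laws_def)

lemma coordinate_measurable: "j < n \<Longrightarrow> (\<lambda>x. x j) \<in> borel_measurable \<mu>"
  by measurable

lemma linear_measurable [measurable]: "(\<lambda>x. \<Sum>j<n. s $ j * x j) \<in> borel_measurable \<mu>"
  by (intro borel_measurable_sum borel_measurable_times borel_measurable_const coordinate_measurable) simp

lemma laplace_kernel_measurable [measurable]: "laplace_kernel n s \<in> borel_measurable \<mu>"
  unfolding laplace_kernel_def by measurable

lemma AE_linear_nonneg:
  assumes "\<And>j. j < n \<Longrightarrow> 0 \<le> s $ j"
  shows "AE x in \<mu>. 0 \<le> (\<Sum>j<n. s $ j * x j)"
  using AE_nonneg by eventually_elim (use assms in \<open>auto intro!: sum_nonneg mult_nonneg_nonneg\<close>)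

lemma orthant_in_domain:
  assumes "s \<in> carrier_vec n" "\<And>j. j < n \<Longrightarrow> 0 \<le> s $ j"
  shows "s \<in> laplace_domain n \<mu>"
proof -
  have "integrable \<mu> (laplace_kernel n s)"
    using AE_linear_nonneg[OF assms(2)]
    by (intro integrable_const_bound[of _ 1]) (auto simp: laplace_kernel_def)
  with assms(1) show ?thesis by (simp add: laplace_domain_def)
qed

lemma laplace_bounds:
  assumes "s \<in> carrier_vec n" "\<And>j. j < n \<Longrightarrow> 0 \<le> s $ j"
  shows "0 \<le> laplace n \<mu> s" "laplace n \<mu> s \<le> 1"
proof -
  show "0 \<le> laplace n \<mu> s"
    unfolding laplace_def by (rule integral_nonneg_AE) (simp add: laplace_kernel_def)
  have "laplace n \<mu> s \<le> integral\<^sup>L \<mu> (\<lambda>_. 1)"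
    unfolding laplace_def
    using orthant_in_domain[OF assms] AE_linear_nonneg[OF assms(2)]
    by (intro integral_mono_AE) (auto simp: laplace_domain_def laplace_kernel_def)
  then show "laplace n \<mu> s \<le> 1" by (simp add: prob_space)
qed

lemma laplace_0: "laplace n \<mu> (0\<^sub>v n) = 1"
proof -
  have "laplace_kernel n (0\<^sub>v n) = (\<lambda>_. 1)" by (auto simp: laplace_kernel_def)
  then show ?thesis by (simp add: laplace_def prob_space)
qed

lemma laplace_ray:
  assumes "v \<in> carrier_vec n"
  shows "laplace n \<mu> (x \<cdot>\<^sub>v v) = expectation (\<lambda>w. exp (- (x * (\<Sum>j<n. v $ j * w j))))"
  unfolding laplace_def laplace_kernel_def
  by (intro Bochner_Integration.integral_cong refl arg_cong[where f = exp] arg_cong[where f = uminus])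
    (use assms in \<open>simp add: sum_distrib_left mult.assoc\<close>)

text \<open>Moving from a point of the domain into the orthant can only decrease the kernel, so the kernel at
  the base point is an integrable majorant, even if that point lies on the boundary of the domain.\<close>

lemma laplace_line_continuous:
  assumes s: "s \<in> laplace_domain n \<mu>" and v: "v \<in> carrier_vec n" "\<And>j. j < n \<Longrightarrow> 0 \<le> v $ j"
  shows "s + recip N \<cdot>\<^sub>v v \<in> laplace_domain n \<mu>"
    and "(\<lambda>N. laplace n \<mu> (s + recip N \<cdot>\<^sub>v v)) \<longlonglongrightarrow> laplace n \<mu> s"
proof -
  have sc: "s \<in> carrier_vec n" and int: "integrable \<mu> (laplace_kernel n s)"
    using s by (auto simp: laplace_domain_def)
  have ker: "laplace_kernel n (s + x \<cdot>\<^sub>v v) w = laplace_kernel n s w * exp (- (x * (\<Sum>j<n. v $ j * w j)))" for x w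
  proof -
    have "(\<Sum>j<n. (s + x \<cdot>\<^sub>v v) $ j * w j) = (\<Sum>j<n. s $ j * w j) + x * (\<Sum>j<n. v $ j * w j)"
      using sc v(1) by (simp add: algebra_simps sum.distrib sum_distrib_left)
    then show ?thesis by (simp add: laplace_kernel_def flip: exp_add)
  qed
  have pos: "AE w in \<mu>. 0 \<le> (\<Sum>j<n. v $ j * w j)"
    by (rule AE_linear_nonneg) (rule v(2))
  have bnd: "AE w in \<mu>. norm (laplace_kernel n (s + recip N \<cdot>\<^sub>v v) w) \<le> laplace_kernel n s w" for N
    using pos
  proof eventually_elim
    case (elim w)
    then have "exp (- (recip N * (\<Sum>j<n. v $ j * w j))) \<le> 1" using recip_pos[of N] by simp
    then show ?case unfolding ker
      by (simp add: laplace_kernel_def mult_left_le)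
  qed
  show "s + recip N \<cdot>\<^sub>v v \<in> laplace_domain n \<mu>"
  proof -
    have "integrable \<mu> (laplace_kernel n (s + recip N \<cdot>\<^sub>v v))"
      by (rule Bochner_Integration.integrable_bound[OF int])
        (simp, rule eventually_mono[OF bnd[of N]], simp)
    then show ?thesis using sc v(1) by (simp add: laplace_domain_def)
  qed
  have "(\<lambda>N. integral\<^sup>L \<mu> (laplace_kernel n (s + recip N \<cdot>\<^sub>v v))) \<longlonglongrightarrow> integral\<^sup>L \<mu> (laplace_kernel n s)"
  proof (rule integral_dominated_convergence[OF _ _ int _ bnd])
    show "AE w in \<mu>. (\<lambda>N. laplace_kernel n (s + recip N \<cdot>\<^sub>v v) w) \<longlonglongrightarrow> laplace_kernel n s w"
    proof (rule AE_I2)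
      fix w
      have "(\<lambda>N. laplace_kernel n s w * exp (- (recip N * (\<Sum>j<n. v $ j * w j)))) \<longlonglongrightarrow>
          laplace_kernel n s w * exp (- (0 * (\<Sum>j<n. v $ j * w j)))"
        by (intro tendsto_intros recip_tendsto)
      then show "(\<lambda>N. laplace_kernel n (s + recip N \<cdot>\<^sub>v v) w) \<longlonglongrightarrow> laplace_kernel n s w"
        by (simp add: ker)
    qed
  qed simp_all
  then show "(\<lambda>N. laplace n \<mu> (s + recip N \<cdot>\<^sub>v v)) \<longlonglongrightarrow> laplace n \<mu> s" by (simp add: laplace_def)
qed

text \<open>Approach a point of the domain along a direction into the orthant on which \<open>Q\<close> does not
  vanish identically.\<close>

lemma rational_identity_on_domain:
  assumes Q: "Q \<in> polys n" "Q \<noteq> 0"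
    and eq: "\<And>s. s \<in> laplace_domain n \<mu> \<Longrightarrow> poly_val n Q s \<noteq> 0 \<Longrightarrow>
      laplace n \<mu> s * poly_val n U s = poly_val n V s"
    and s: "s \<in> laplace_domain n \<mu>"
  shows "laplace n \<mu> s * poly_val n U s = poly_val n V s"
proof -
  have sc: "s \<in> carrier_vec n" using s by (simp add: laplace_domain_def)
  obtain s1 where s1: "s1 \<in> carrier_vec n" "\<And>j. j < n \<Longrightarrow> s1 $ j > s $ j" "poly_val n Q s1 \<noteq> 0"
    using exists_poly_val_nonzero_large[OF Q, of "\<lambda>j. s $ j"] by blast
  define v where "v = s1 - s"
  have v: "v \<in> carrier_vec n" "\<And>j. j < n \<Longrightarrow> 0 \<le> v $ j"
    using s1 sc by (auto simp: v_def less_imp_le)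
  have "s + 1 \<cdot>\<^sub>v v = s1" using s1(1) sc by (auto simp: v_def intro!: eq_vecI)
  then have "poly (line_poly n s v Q) 1 \<noteq> 0" using s1(3) by (simp add: poly_line_poly[OF sc v(1)])
  then have "line_poly n s v Q \<noteq> 0" by auto
  from eventually_poly_recip_nonzero[OF this]
  have "eventually (\<lambda>N. laplace n \<mu> (s + recip N \<cdot>\<^sub>v v) * poly (line_poly n s v U) (recip N)
      = poly (line_poly n s v V) (recip N)) sequentially"
    by eventually_elim
      (use eq laplace_line_continuous(1)[OF s v] in \<open>simp add: poly_line_poly[OF sc v(1)]\<close>)
  then have "(\<lambda>N. laplace n \<mu> (s + recip N \<cdot>\<^sub>v v) * poly (line_poly n s v U) (recip N)) \<longlonglongrightarrow> poly (line_poly n s v V) 0"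
    using poly_recip_tendsto[of "line_poly n s v V"] by (simp cong: tendsto_cong)
  moreover have "(\<lambda>N. laplace n \<mu> (s + recip N \<cdot>\<^sub>v v) * poly (line_poly n s v U) (recip N)) \<longlonglongrightarrow>
      laplace n \<mu> s * poly (line_poly n s v U) 0"
    by (intro tendsto_mult laplace_line_continuous(2)[OF s v] poly_recip_tendsto)
  ultimately have "laplace n \<mu> s * poly (line_poly n s v U) 0 = poly (line_poly n s v V) 0"
    by (rule LIMSEQ_unique[rotated])
  moreover have "s + 0 \<cdot>\<^sub>v v = s" using sc v(1) by (auto intro!: eq_vecI)
  ultimately show ?thesis by (simp add: poly_line_poly[OF sc v(1)])
qed

end

section \<open>Taylor polynomials and reduction of the denominator\<close>

locale rational_law = nonneg_law +
  fixes P Q :: rpoly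
  assumes P: "P \<in> polys n" and Q: "Q \<in> polys n" and Q_nonzero: "Q \<noteq> 0"
    and identity: "\<And>s. s \<in> laplace_domain n \<mu> \<Longrightarrow> laplace n \<mu> s * poly_val n Q s = poly_val n P s"
begin

text \<open>The direction is chosen with entries above 1, so that the linear form dominates each coordinate and
  its moments control all mixed moments.\<close>

lemma coordinate_power_sum_integrable:
  "\<exists>v :: real Matrix.vec. (\<forall>j<n. v $ j > 1) \<and> (\<forall>k. integrable \<mu> (\<lambda>x. (\<Sum>j<n. v $ j * x j) ^ k))"
proof -
  obtain v :: "real Matrix.vec" where v: "v \<in> carrier_vec n" "\<And>j. j < n \<Longrightarrow> v $ j > 1" "poly_val n Q v \<noteq> 0"
    using exists_poly_val_nonzero_large[OF Q Q_nonzero, of "\<lambda>_. 1"] by blast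
  have v0: "0 \<le> v $ j" if "j < n" for j using v(2)[OF that] by simp
  have "1 \<cdot>\<^sub>v v = v" using v(1) by auto
  then have "poly (ray_poly n v Q) 1 \<noteq> 0" using v(3) by (simp add: poly_ray_poly[OF v(1)])
  then have q: "ray_poly n v Q \<noteq> 0" by auto
  have pos: "AE x in \<mu>. 0 \<le> (\<Sum>j<n. v $ j * x j)" by (rule AE_linear_nonneg) (rule v0)
  have "integrable \<mu> (\<lambda>x. (\<Sum>j<n. v $ j * x j) ^ k)" for k
  proof (rule moments_finite_of_rational_transform[OF linear_measurable pos q])
    fix x :: real assume x: "x > 0"
    have "x \<cdot>\<^sub>v v \<in> laplace_domain n \<mu>"
      by (rule orthant_in_domain) (use v(1) v0 x in auto)
    from identity[OF this]
    show "expectation (\<lambda>w. exp (- (x * (\<Sum>j<n. v $ j * w j)))) * poly (ray_poly n v Q) x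
        = poly (ray_poly n v P) x"
      by (simp add: laplace_ray[OF v(1)] poly_ray_poly[OF v(1)])
  qed
  with v(2) show ?thesis by blast
qed

lemma word_integrable:
  fixes w :: "nat \<Rightarrow> nat"
  assumes w: "w \<in> {..<i} \<rightarrow>\<^sub>E {..<n}"
  shows "integrable \<mu> (\<lambda>x. \<Prod>l<i. x (w l))"
proof -
  obtain v :: "real Matrix.vec" where "\<forall>j<n. v $ j > 1"
    and int: "\<forall>k. integrable \<mu> (\<lambda>x. (\<Sum>j<n. v $ j * x j) ^ k)"
    using coordinate_power_sum_integrable by (elim exE conjE)
  then have v: "v $ j > 1" if "j < n" for j using that by simp
  show ?thesis
  proof (rule Bochner_Integration.integrable_bound[OF spec[OF int, of i]])
    show "(\<lambda>x. \<Prod>l<i. x (w l)) \<in> borel_measurable \<mu>"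
      using w by (intro borel_measurable_prod coordinate_measurable) auto
    show "AE x in \<mu>. norm (\<Prod>l<i. x (w l)) \<le> norm ((\<Sum>j<n. v $ j * x j) ^ i)"
      using AE_nonneg
    proof eventually_elim
      case (elim x)
      have le: "x j \<le> (\<Sum>j<n. v $ j * x j)" if "j < n" for j
      proof -
        have "x j \<le> v $ j * x j" using elim v[of j] that mult_right_mono[of 1 "v $ j" "x j"] by auto
        also have "\<dots> \<le> (\<Sum>j<n. v $ j * x j)"
        proof (rule member_le_sum)
          show "0 \<le> v $ i * x i" if "i \<in> {..<n} - {j}" for i
            using elim v[of i] that by simp
        qed (use that in auto)
        finally show ?thesis .
      qed
      have mem: "w l < n" if "l < i" for l using w that by auto
      have "(\<Prod>l<i. x (w l)) \<le> (\<Prod>l<i. \<Sum>j<n. v $ j * x j)"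
        using elim le mem by (intro prod_mono) auto
      also have "\<dots> = (\<Sum>j<n. v $ j * x j) ^ i" by simp
      finally have "(\<Prod>l<i. x (w l)) \<le> (\<Sum>j<n. v $ j * x j) ^ i" .
      moreover have "0 \<le> (\<Prod>l<i. x (w l))" using elim mem by (intro prod_nonneg) auto
      ultimately show ?case by simp
    qed
  qed
qed

lemma linear_power_expand:
  "(\<Sum>j<n. s $ j * x j) ^ i = (\<Sum>w\<in>{..<i} \<rightarrow>\<^sub>E {..<n}. (\<Prod>l<i. s $ w l) * (\<Prod>l<i. x (w l :: nat) :: real))"
proof -
  have "(\<Sum>j<n. s $ j * x j) ^ i = (\<Prod>l<i. \<Sum>j\<in>{..<n}. s $ j * x j)" by simp
  also have "\<dots> = (\<Sum>w\<in>{..<i} \<rightarrow>\<^sub>E {..<n}. \<Prod>l<i. s $ w l * x (w l))"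
    by (rule prod_sum_PiE) auto
  finally show ?thesis by (simp add: prod.distrib)
qed

lemma linear_power_integrable: "integrable \<mu> (\<lambda>x. (\<Sum>j<n. s $ j * x j) ^ i)"
  unfolding linear_power_expand
  by (intro Bochner_Integration.integrable_sum integrable_mult_right word_integrable)

text \<open>The Taylor polynomial of the transform at 0, with \<open>(\<Sum>j<n. s\<^sub>j x\<^sub>j)\<^sup>i\<close> expanded over words
  \<open>w\<close> of length \<open>i\<close> rather than over multi-indices, which avoids multinomial coefficients.\<close>

definition taylor_poly :: "nat \<Rightarrow> rpoly" where
  "taylor_poly k = (\<Sum>i<Suc k. \<Sum>w\<in>{..<i} \<rightarrow>\<^sub>E {..<n}.
     Poly_Mapping.single 0 ((-1) ^ i / fact i * expectation (\<lambda>x. \<Prod>l<i. x (w l))) * (\<Prod>l<i. rvar (w l)))"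

lemma poly_val_taylor_poly:
  "poly_val n (taylor_poly k) s =
     (\<Sum>i<Suc k. (-1) ^ i / fact i * expectation (\<lambda>x. (\<Sum>j<n. s $ j * x j) ^ i))"
proof -
  have "(\<Sum>w\<in>{..<i} \<rightarrow>\<^sub>E {..<n}. poly_val n (Poly_Mapping.single 0 ((-1) ^ i / fact i * expectation (\<lambda>x. \<Prod>l<i. x (w l)))
          * (\<Prod>l<i. rvar (w l))) s)
      = (-1) ^ i / fact i * expectation (\<lambda>x. (\<Sum>j<n. s $ j * x j) ^ i)" for i
  proof -
    have "expectation (\<lambda>x. (\<Sum>j<n. s $ j * x j) ^ i)
        = (\<Sum>w\<in>{..<i} \<rightarrow>\<^sub>E {..<n}. expectation (\<lambda>x. (\<Prod>l<i. s $ w l) * (\<Prod>l<i. x (w l))))"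
      unfolding linear_power_expand
      by (intro Bochner_Integration.integral_sum integrable_mult_right word_integrable)
    also have "\<dots> = (\<Sum>w\<in>{..<i} \<rightarrow>\<^sub>E {..<n}. (\<Prod>l<i. s $ w l) * expectation (\<lambda>x. \<Prod>l<i. x (w l)))"
      by (intro sum.cong refl integral_mult_right_zero)
    finally have E: "expectation (\<lambda>x. (\<Sum>j<n. s $ j * x j) ^ i)
        = (\<Sum>w\<in>{..<i} \<rightarrow>\<^sub>E {..<n}. (\<Prod>l<i. s $ w l) * expectation (\<lambda>x. \<Prod>l<i. x (w l)))" .
    have "poly_val n (\<Prod>l<i. rvar (w l)) s = (\<Prod>l<i. s $ w l)" if "w \<in> {..<i} \<rightarrow>\<^sub>E {..<n}" for w
      unfolding poly_val_prod using that by (intro prod.cong refl poly_val_rvar) auto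
    then show ?thesis unfolding E sum_distrib_left
      by (intro sum.cong) (auto simp: poly_val_mult)
  qed
  then show ?thesis by (simp add: taylor_poly_def poly_val_sum del: sum.lessThan_Suc)
qed

lemma taylor_poly_keys:
  assumes "a \<in> Poly_Mapping.keys (taylor_poly k)"
  shows "Poly_Mapping.keys a \<subseteq> {..<n}" "exponent_sum n a \<le> k"
proof -
  let ?f = "\<lambda>i. \<Sum>w\<in>{..<i} \<rightarrow>\<^sub>E {..<n}.
     Poly_Mapping.single 0 ((-1) ^ i / fact i * expectation (\<lambda>x. \<Prod>l<i. x (w l))) * (\<Prod>l<i. rvar (w l))"
  have g: "?f i \<in> homogeneous n i" for i
  proof (rule homogeneous_sum)
    fix w assume "w \<in> {..<i} \<rightarrow>\<^sub>E {..<n}"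
    then have "(\<Prod>l<i. rvar (w l)) \<in> homogeneous n i" by (intro homogeneous_prod homogeneous_rvar) auto
    from homogeneous_mult[OF homogeneous_const this]
    show "Poly_Mapping.single 0 ((-1) ^ i / fact i * expectation (\<lambda>x. \<Prod>l<i. x (w l))) * (\<Prod>l<i. rvar (w l)) \<in> homogeneous n i"
      by simp
  qed
  obtain i where "i < Suc k" "a \<in> Poly_Mapping.keys (?f i)"
    using assms keys_sum[of ?f "{..<Suc k}"] unfolding taylor_poly_def by blast
  with g[of i] show "Poly_Mapping.keys a \<subseteq> {..<n}" "exponent_sum n a \<le> k"
    unfolding homogeneous_def by auto
qed

lemma laplace_taylor_bound:
  assumes v: "v \<in> carrier_vec n" "\<And>j. j < n \<Longrightarrow> v $ j > 0" and x: "x > 0"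
  shows "\<bar>laplace n \<mu> (x \<cdot>\<^sub>v v) - poly_val n (taylor_poly k) (x \<cdot>\<^sub>v v)\<bar>
    \<le> expectation (\<lambda>w. (\<Sum>j<n. v $ j * w j) ^ Suc k) / fact (Suc k) * x ^ Suc k"
proof -
  define Y where "Y w = (\<Sum>j<n. v $ j * w j)" for w :: "nat \<Rightarrow> real"
  have pos: "AE w in \<mu>. 0 \<le> Y w"
    unfolding Y_def by (rule AE_linear_nonneg) (use v(2) in \<open>auto intro: less_imp_le\<close>)
  have Y_int: "integrable \<mu> (\<lambda>w. Y w ^ i)" for i unfolding Y_def by (rule linear_power_integrable)
  have Y_meas [measurable]: "Y \<in> borel_measurable \<mu>" unfolding Y_def by measurable
  have exp_int: "integrable \<mu> (\<lambda>w. exp (- (x * Y w)))"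
    using pos x by (intro integrable_const_bound[of _ 1]) auto
  have tint: "integrable \<mu> (\<lambda>w. (- (x * Y w)) ^ i / fact i)" for i
    using Y_int[of i] by (simp add: power_mult_distrib power_minus[of "_ * _"])
  have scal: "(\<Sum>j<n. (x \<cdot>\<^sub>v v) $ j * w j) = x * Y w" for w :: "nat \<Rightarrow> real"
    unfolding Y_def using v(1) by (simp add: sum_distrib_left mult.assoc)
  have "poly_val n (taylor_poly k) (x \<cdot>\<^sub>v v) = (\<Sum>i<Suc k. expectation (\<lambda>w. (- (x * Y w)) ^ i / fact i))"
    unfolding poly_val_taylor_poly scal
    by (intro sum.cong refl) (simp add: power_mult_distrib power_minus[of "_ * _"])
  also have "\<dots> = expectation (\<lambda>w. \<Sum>i<Suc k. (- (x * Y w)) ^ i / fact i)"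
    using tint by (intro Bochner_Integration.integral_sum[symmetric]) simp
  finally have "laplace n \<mu> (x \<cdot>\<^sub>v v) - poly_val n (taylor_poly k) (x \<cdot>\<^sub>v v)
      = expectation (\<lambda>w. exp (- (x * Y w)) - (\<Sum>i<Suc k. (- (x * Y w)) ^ i / fact i))"
    unfolding laplace_ray[OF v(1)] Y_def[symmetric]
    using tint by (simp add: exp_int Bochner_Integration.integral_diff Bochner_Integration.integrable_sum
        del: sum.lessThan_Suc)
  also have "\<bar>\<dots>\<bar> \<le> expectation (\<lambda>w. \<bar>exp (- (x * Y w)) - (\<Sum>i<Suc k. (- (x * Y w)) ^ i / fact i)\<bar>)"
    by (rule integral_abs_bound)
  also have "\<dots> = expectation (\<lambda>w. \<bar>exp_remainder (Suc k) (x * Y w)\<bar>)"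
    by (simp add: exp_remainder_def abs_mult power_abs del: sum.lessThan_Suc)
  also have "\<dots> \<le> expectation (\<lambda>w. Y w ^ Suc k / fact (Suc k) * x ^ Suc k)"
  proof (rule integral_mono_AE)
    show "integrable \<mu> (\<lambda>w. Y w ^ Suc k / fact (Suc k) * x ^ Suc k)" using Y_int[of "Suc k"] by simp
    show "integrable \<mu> (\<lambda>w. \<bar>exp_remainder (Suc k) (x * Y w)\<bar>)"
      unfolding exp_remainder_def
      using tint by (intro integrable_abs integrable_mult_right Bochner_Integration.integrable_diff exp_int
          Bochner_Integration.integrable_sum) simp
    show "AE w in \<mu>. \<bar>exp_remainder (Suc k) (x * Y w)\<bar> \<le> Y w ^ Suc k / fact (Suc k) * x ^ Suc k"
      using pos
    proof eventually_elim
      case (elim w)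
      then have *: "0 \<le> x * Y w" using x by simp
      have "\<bar>exp_remainder (Suc k) (x * Y w)\<bar> \<le> (x * Y w) ^ Suc k / fact (Suc k)"
        using exp_remainder_nonneg[OF *, of "Suc k"] exp_remainder_le[OF *, of "Suc k"] by simp
      also have "\<dots> = Y w ^ Suc k / fact (Suc k) * x ^ Suc k" by (simp add: power_mult_distrib del: power_Suc)
      finally show ?case .
    qed
  qed
  also have "\<dots> = expectation (\<lambda>w. Y w ^ Suc k) / fact (Suc k) * x ^ Suc k"
    by (simp del: power_Suc)
  finally show ?thesis by (simp only: Y_def)
qed

definition remainder_poly :: "nat \<Rightarrow> rpoly" where
  "remainder_poly k = P - Q * taylor_poly k"

definition degree_bound :: nat where
  "degree_bound = total_deg n P + total_deg n Q"

lemma remainder_poly_in_polys: "remainder_poly k \<in> polys n"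
proof -
  have "taylor_poly k \<in> polys n" using taylor_poly_keys(1) by (auto simp: polys_def)
  then show ?thesis unfolding remainder_poly_def by (intro polys_diff polys_mult P Q)
qed

lemma remainder_poly_degree_le:
  assumes "a \<in> Poly_Mapping.keys (remainder_poly k)"
  shows "exponent_sum n a \<le> k + degree_bound"
proof -
  have "a \<in> Poly_Mapping.keys P \<or> a \<in> Poly_Mapping.keys (Q * taylor_poly k)"
    using assms keys_rpoly_diff[of P] unfolding remainder_poly_def by blast
  then show ?thesis
  proof
    assume "a \<in> Poly_Mapping.keys (Q * taylor_poly k)"
    then obtain b c where "b \<in> Poly_Mapping.keys Q" "c \<in> Poly_Mapping.keys (taylor_poly k)" "a = b + c"
      by (rule keys_mult_elim)
    then show ?thesis
      using taylor_poly_keys(2)[of c k] exponent_sum_le_total_deg[of b Q n]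
      by (simp add: exponent_sum_add degree_bound_def)
  qed (use exponent_sum_le_total_deg[of a P n] in \<open>simp add: degree_bound_def\<close>)
qed

text \<open>On each ray into the orthant the remainder is \<open>Q\<close> times the Taylor error of the transform,
  hence \<open>O(x\<^sup>k\<^sup>+\<^sup>1)\<close>; so its terms of degree up to \<open>k\<close> vanish on an open set of directions.\<close>

lemma remainder_poly_degree_gt:
  assumes a: "a \<in> Poly_Mapping.keys (remainder_poly k)"
  shows "k < exponent_sum n a"
proof (rule ccontr)
  assume "\<not> ?thesis"
  then have le: "exponent_sum n a \<le> k" by simp
  obtain v where v: "v \<in> carrier_vec n" "\<And>j. j < n \<Longrightarrow> v $ j > 0"
    "Polynomial.coeff (ray_poly n v (remainder_poly k)) (exponent_sum n a) \<noteq> 0"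
    using exists_coeff_ray_nonzero[OF remainder_poly_in_polys a] by blast
  have "bounded (poly (ray_poly n v Q) ` {0..1})"
    by (intro compact_imp_bounded compact_continuous_image continuous_intros) auto
  then obtain B where B: "\<forall>x\<in>{0..1}. \<bar>poly (ray_poly n v Q) x\<bar> \<le> B"
    by (auto simp: bounded_iff)
  define D where "D = expectation (\<lambda>w. (\<Sum>j<n. v $ j * w j) ^ Suc k) / fact (Suc k)"
  have "\<bar>poly (ray_poly n v (remainder_poly k)) x\<bar> \<le> (B * D) * x ^ Suc k" if x: "0 < x" "x \<le> 1" for x
  proof -
    have dom: "x \<cdot>\<^sub>v v \<in> laplace_domain n \<mu>"
      by (rule orthant_in_domain) (use v x in \<open>auto intro: less_imp_le\<close>)
    have "poly (ray_poly n v (remainder_poly k)) x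
        = poly (ray_poly n v Q) x * (laplace n \<mu> (x \<cdot>\<^sub>v v) - poly_val n (taylor_poly k) (x \<cdot>\<^sub>v v))"
      unfolding poly_ray_poly[OF v(1)] remainder_poly_def poly_val_diff poly_val_mult
      using identity[OF dom] by (simp add: algebra_simps)
    also have "\<bar>\<dots>\<bar> \<le> B * (D * x ^ Suc k)"
      unfolding abs_mult D_def
      using bspec[OF B, of x] x laplace_taylor_bound[OF v(1,2) x(1), of k] by (intro mult_mono) auto
    finally show ?thesis by (simp add: mult.assoc)
  qed
  from coeff_zero_of_small[OF this le] v(3) show False by simp
qed

text \<open>The variable with index \<open>n\<close> homogenizes the remainder to degree \<open>k + degree_bound\<close>. Evaluation
  with \<^const>\<open>poly_val\<close> gives this variable the value 1, so it undoes the homogenization.\<close>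

definition homogenized :: "nat \<Rightarrow> rpoly" where
  "homogenized k = (\<Sum>a\<in>Poly_Mapping.keys (remainder_poly k).
     Poly_Mapping.single (a + Poly_Mapping.single n (k + degree_bound - exponent_sum n a))
       (Poly_Mapping.lookup (remainder_poly k) a))"

lemma poly_val_homogenized: "poly_val n (homogenized k) s = poly_val n (remainder_poly k) s"
proof -
  have "monomial_val n (Poly_Mapping.single n e) s = 1" for e
    unfolding monomial_val_def by (intro prod.neutral) (auto simp: lookup_single when_def)
  then show ?thesis
    by (simp add: homogenized_def poly_val_sum poly_val_single monomial_val_add)
      (simp add: poly_val_def monomial_val_def)
qed

lemma homogenized_exponents:
  assumes "a \<in> Poly_Mapping.keys (homogenized k)"
  shows "Poly_Mapping.keys a \<subseteq> {..<Suc n}" "exponent_sum (Suc n) a = k + degree_bound"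
    "Poly_Mapping.lookup a n \<le> degree_bound"
proof -
  obtain b where b: "b \<in> Poly_Mapping.keys (remainder_poly k)"
    "a \<in> Poly_Mapping.keys (Poly_Mapping.single (b + Poly_Mapping.single n (k + degree_bound - exponent_sum n b))
       (Poly_Mapping.lookup (remainder_poly k) b))"
    using assms keys_sum[of "\<lambda>a. Poly_Mapping.single (a + Poly_Mapping.single n (k + degree_bound - exponent_sum n a))
       (Poly_Mapping.lookup (remainder_poly k) a)" "Poly_Mapping.keys (remainder_poly k)"]
    unfolding homogenized_def by blast
  define e where "e = k + degree_bound - exponent_sum n b"
  from b(2) have a: "a = b + Poly_Mapping.single n e" by (auto simp: e_def split: if_splits)
  have kb: "Poly_Mapping.keys b \<subseteq> {..<n}"
    using remainder_poly_in_polys[of k] b(1) by (auto simp: polys_def)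
  then have "n \<notin> Poly_Mapping.keys b" by auto
  then have ln: "Poly_Mapping.lookup a n = e"
    by (simp add: a lookup_add not_in_keys_iff_lookup_eq_zero)
  have es: "exponent_sum n a = exponent_sum n b"
    by (simp add: a exponent_sum_add) (auto simp: exponent_sum_def lookup_single when_def)
  show "Poly_Mapping.keys a \<subseteq> {..<Suc n}" using kb unfolding a keys_exponent_add by (auto split: if_splits)
  show "exponent_sum (Suc n) a = k + degree_bound"
    using remainder_poly_degree_le[OF b(1)] by (simp add: exponent_sum_Suc ln es e_def)
  show "Poly_Mapping.lookup a n \<le> degree_bound"
    using remainder_poly_degree_gt[OF b(1)] by (simp add: ln e_def)
qed

text \<open>A dependence \<open>R\<^sub>k = \<Sum>i<k. b\<^sub>i R\<^sub>i\<close> between the remainders \<open>R\<^sub>i = P - Q L\<^sub>i\<close> reads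
  \<open>(1 - \<Sum>i<k. b\<^sub>i) P = Q (L\<^sub>k - \<Sum>i<k. b\<^sub>i L\<^sub>i)\<close>, and each \<open>b\<^sub>i\<close> vanishes at 0 because its
  degree is positive.\<close>

lemma denominator_normalizable:
  obtains U V where "poly_val n U (0\<^sub>v n) = 1"
    "\<And>s. s \<in> laplace_domain n \<mu> \<Longrightarrow> laplace n \<mu> s * poly_val n U s = poly_val n V s"
proof -
  have "\<exists>k. homogenized k \<in> homogeneous_combinations n homogenized k"
  proof (rule homogeneous_sequence_dependent[where d = degree_bound])
    show "homogenized k \<in> homogeneous (Suc n) (k + degree_bound)" for k
      using homogenized_exponents(1,2) unfolding homogeneous_def by blast
    show "Poly_Mapping.lookup a n \<le> degree_bound" if "a \<in> Poly_Mapping.keys (homogenized k)" for k a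
      by (rule homogenized_exponents(3)[OF that])
  qed
  then obtain k b where b: "\<forall>i<k. b i \<in> homogeneous n (k - i)" "homogenized k = (\<Sum>i<k. b i * homogenized i)"
    unfolding homogeneous_combinations_def by blast
  define U where "U = 1 - (\<Sum>i<k. b i)"
  define V where "V = taylor_poly k - (\<Sum>i<k. b i * taylor_poly i)"
  have U0: "poly_val n U (0\<^sub>v n) = 1"
  proof -
    have "poly_val n (b i) (0\<^sub>v n) = 0" if "i < k" for i
      using b(1) that by (intro poly_val_homogeneous_at_0[of "b i" n "k - i"]) auto
    then show ?thesis by (simp add: U_def poly_val_diff poly_val_sum)
  qed
  have UPQV: "poly_val n U s * poly_val n P s = poly_val n Q s * poly_val n V s" for s
  proof -
    have R: "poly_val n (remainder_poly i) s = poly_val n P s - poly_val n Q s * poly_val n (taylor_poly i) s" for i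
      by (simp add: remainder_poly_def poly_val_diff poly_val_mult)
    have "poly_val n (remainder_poly k) s = (\<Sum>i<k. poly_val n (b i) s * poly_val n (remainder_poly i) s)"
      using arg_cong[OF b(2), of "\<lambda>p. poly_val n p s"]
      by (simp add: poly_val_sum poly_val_mult poly_val_homogenized)
    then show ?thesis unfolding R
      by (simp add: U_def V_def poly_val_diff poly_val_sum poly_val_mult algebra_simps sum_subtractf
          sum_distrib_left sum_distrib_right)
  qed
  have "laplace n \<mu> s * poly_val n U s = poly_val n V s" if s: "s \<in> laplace_domain n \<mu>" for s
  proof (rule rational_identity_on_domain[OF Q Q_nonzero _ s])
    fix s assume s: "s \<in> laplace_domain n \<mu>" "poly_val n Q s \<noteq> 0"
    have "poly_val n Q s * (laplace n \<mu> s * poly_val n U s)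
        = poly_val n U s * (laplace n \<mu> s * poly_val n Q s)" by simp
    also have "\<dots> = poly_val n Q s * poly_val n V s" by (simp only: identity[OF s(1)] UPQV)
    finally show "laplace n \<mu> s * poly_val n U s = poly_val n V s" using s(2) by simp
  qed
  with U0 show thesis by (rule that)
qed

end

section \<open>Polynomials in shifted variables\<close>

text \<open>Products of the factors \<open>s\<^sub>j + 1\<close> instead of monomials: they all equal 1 at \<open>s = 0\<close>, which will
  turn the vector of all ones into the solution of the linear system at that point.\<close>

definition shifted_word :: "nat list \<Rightarrow> real Matrix.vec \<Rightarrow> real" where
  "shifted_word w s = (\<Prod>j\<leftarrow>w. s $ j + 1)"

lemma shifted_word_simps [simp]:
  "shifted_word [] s = 1" "shifted_word (j # w) s = (s $ j + 1) * shifted_word w s"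
  by (simp_all add: shifted_word_def)

definition word_combination :: "(real \<times> nat list) list \<Rightarrow> real Matrix.vec \<Rightarrow> real" where
  "word_combination xs s = (\<Sum>(c, w)\<leftarrow>xs. c * shifted_word w s)"

definition word_polynomial :: "nat \<Rightarrow> (real Matrix.vec \<Rightarrow> real) \<Rightarrow> bool" where
  "word_polynomial n f \<longleftrightarrow>
     (\<exists>xs. (\<forall>cw\<in>set xs. set (snd cw) \<subseteq> {..<n}) \<and> (\<forall>s. f s = word_combination xs s))"

lemma word_polynomial_const: "word_polynomial n (\<lambda>_. c)"
  unfolding word_polynomial_def by (rule exI[of _ "[(c, [])]"]) (simp add: word_combination_def)

lemma word_polynomial_add:
  assumes "word_polynomial n f" "word_polynomial n g"
  shows "word_polynomial n (\<lambda>s. f s + g s)"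
proof -
  obtain xs ys where "\<forall>cw\<in>set xs. set (snd cw) \<subseteq> {..<n}" "\<forall>s. f s = word_combination xs s"
    "\<forall>cw\<in>set ys. set (snd cw) \<subseteq> {..<n}" "\<forall>s. g s = word_combination ys s"
    using assms unfolding word_polynomial_def by blast
  then show ?thesis unfolding word_polynomial_def
    by (intro exI[of _ "xs @ ys"]) (auto simp: word_combination_def)
qed

lemma word_polynomial_mult_var:
  assumes "word_polynomial n f" "j < n"
  shows "word_polynomial n (\<lambda>s. f s * s $ j)"
proof -
  obtain xs where xs: "\<forall>cw\<in>set xs. set (snd cw) \<subseteq> {..<n}" "\<forall>s. f s = word_combination xs s"
    using assms(1) unfolding word_polynomial_def by blast
  let ?ys = "map (\<lambda>(c, w). (c, j # w)) xs @ map (\<lambda>(c, w). (- c, w)) xs"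
  have "word_combination ?ys s = word_combination xs s * s $ j" for s
    by (induction xs) (auto simp: word_combination_def algebra_simps)
  moreover have "\<forall>cw\<in>set ?ys. set (snd cw) \<subseteq> {..<n}" using xs(1) assms(2) by fastforce
  ultimately show ?thesis unfolding word_polynomial_def using xs(2) by (intro exI[of _ ?ys]) simp
qed

lemma word_polynomial_poly_val: "word_polynomial n (poly_val n P)"
proof -
  have power: "word_polynomial n (\<lambda>s. f s * s $ j ^ e)" if "word_polynomial n f" "j < n" for f j e
  proof (induction e)
    case (Suc e)
    from word_polynomial_mult_var[OF this that(2)] show ?case by (simp add: mult_ac)
  qed (use that in simp)
  have mon: "word_polynomial n (\<lambda>s. c * (\<Prod>j<m. s $ j ^ Poly_Mapping.lookup a j))" if "m \<le> n" for c m a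
    using that
  proof (induction m)
    case (Suc m)
    then have "word_polynomial n (\<lambda>s. c * (\<Prod>j<m. s $ j ^ Poly_Mapping.lookup a j))" by simp
    from power[OF this, of m] Suc.prems show ?case by (simp add: mult_ac)
  qed (simp add: word_polynomial_const)
  have "word_polynomial n (\<lambda>s. \<Sum>a\<in>A. Poly_Mapping.lookup P a * (\<Prod>j<n. s $ j ^ Poly_Mapping.lookup a j))" for A
  proof (induction A rule: infinite_finite_induct)
    case (insert a A)
    then show ?case using word_polynomial_add[OF mon insert.IH, of n "Poly_Mapping.lookup P a" a] by simp
  qed (simp_all add: word_polynomial_const)
  then show ?thesis unfolding poly_val_def .
qed

definition words :: "nat \<Rightarrow> nat \<Rightarrow> nat list set" where
  "words n D = {w. set w \<subseteq> {..<n} \<and> length w \<le> D}"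

lemma finite_words: "finite (words n D)"
  unfolding words_def by (rule finite_lists_length_le) simp

lemma word_polynomial_coefficients:
  assumes "word_polynomial n f"
  obtains D0 where "\<And>D. D \<ge> D0 \<Longrightarrow> \<exists>c. \<forall>s. f s = (\<Sum>w\<in>words n D. c w * shifted_word w s)"
proof -
  obtain xs where xs: "\<forall>cw\<in>set xs. set (snd cw) \<subseteq> {..<n}" "\<forall>s. f s = word_combination xs s"
    using assms unfolding word_polynomial_def by blast
  define D0 where "D0 = Max (insert 0 ((\<lambda>cw. length (snd cw)) ` set xs))"
  have len: "length (snd cw) \<le> D0" if "cw \<in> set xs" for cw
    unfolding D0_def using that by (intro Max_ge) auto
  show thesis
  proof (rule that)
    fix D assume "D \<ge> D0"
    define c where "c w = (\<Sum>(d, w')\<leftarrow>xs. if w' = w then d else 0)" for w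
    have "(\<Sum>w\<in>words n D. (\<Sum>(d, w')\<leftarrow>ys. if w' = w then d else 0) * shifted_word w s)
        = word_combination ys s" if "set ys \<subseteq> set xs" for ys s
      using that
    proof (induction ys)
      case (Cons y ys)
      obtain d w' where y: "y = (d, w')" by force
      then have "w' \<in> words n D"
        using Cons.prems bspec[OF xs(1), of y] len[of y] \<open>D \<ge> D0\<close> by (auto simp: words_def)
      then have "(\<Sum>w\<in>words n D. (if w' = w then d else 0) * shifted_word w s) = d * shifted_word w' s"
        by (simp add: if_distrib[of "\<lambda>x. x * _"] finite_words cong: if_cong)
      then show ?case using Cons by (simp add: y word_combination_def distrib_right sum.distrib)
    qed (simp add: word_combination_def)
    from this[of xs] have "f s = (\<Sum>w\<in>words n D. c w * shifted_word w s)" for s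
      using xs(2) by (simp add: c_def)
    then show "\<exists>c. \<forall>s. f s = (\<Sum>w\<in>words n D. c w * shifted_word w s)" by blast
  qed
qed

section \<open>A pencil with prescribed denominator\<close>

text \<open>The system behind the next three definitions has an unknown \<open>X (w, False)\<close> for each word, meant to
  be the product belonging to \<open>w\<close> divided by \<open>U\<close>, and a copy \<open>X (w, True)\<close> of the unknown of
  the tail of \<open>w\<close>. The copy is needed because a diagonal entry can only multiply the unknown of its
  own row, while one word is the tail of several others. The equations are
  \<open>(s\<^sub>j + 1) X (j # w, True) = X (j # w, False)\<close>, \<open>X (j # w, True) = X (w, False)\<close> and, for the
  coefficients \<open>u\<close> of \<open>U\<close>, \<open>(\<Sum>w. u w * X (w, False)) = 1\<close>. The row \<open>([], True)\<close> merely
  equates the two unknowns of the empty word.\<close>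

definition pencil_const :: "(nat list \<Rightarrow> real) \<Rightarrow> nat list \<times> bool \<Rightarrow> nat list \<times> bool \<Rightarrow> real" where
  "pencil_const u i k = (if snd i then of_bool (k = (fst i, True)) - of_bool (k = (fst i, False))
     else if fst i = [] then (if snd k then 0 else u (fst k))
     else of_bool (k = (fst i, True)) - of_bool (k = (tl (fst i), False)))"

definition pencil_linear :: "nat list \<times> bool \<Rightarrow> nat \<Rightarrow> real" where
  "pencil_linear i j = of_bool (snd i \<and> fst i \<noteq> [] \<and> hd (fst i) = j)"

definition pencil_rhs :: "nat list \<times> bool \<Rightarrow> real" where
  "pencil_rhs i = of_bool (i = ([], False))"

lemma sum_of_bool_eq:
  assumes "finite I" "k0 \<in> I"
  shows "(\<Sum>k\<in>I. of_bool (k = k0) * X k) = (X k0 :: real)"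
proof -
  have "(\<Sum>k\<in>I. of_bool (k = k0) * X k) = (\<Sum>k\<in>I. if k = k0 then X k else 0)"
    by (intro sum.cong) auto
  then show ?thesis using assms by simp
qed

lemma words_tl: "w \<in> words n D \<Longrightarrow> tl w \<in> words n D"
  unfolding words_def by (cases w) auto

lemma pencil_const_rows:
  fixes X :: "nat list \<times> bool \<Rightarrow> real" and n D :: nat
  defines "I \<equiv> words n D \<times> UNIV"
  assumes w: "w \<in> words n D"
  shows "(\<Sum>k\<in>I. pencil_const u (w, True) k * X k) = X (w, True) - X (w, False)"
    and "w \<noteq> [] \<Longrightarrow> (\<Sum>k\<in>I. pencil_const u (w, False) k * X k) = X (w, True) - X (tl w, False)"
    and "(\<Sum>k\<in>I. pencil_const u ([], False) k * X k) = (\<Sum>w\<in>words n D. u w * X (w, False))"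
proof -
  have fin: "finite I" by (simp add: I_def finite_words)
  have mem: "(w, b) \<in> I" "(tl w, b) \<in> I" for b using w words_tl[OF w] by (auto simp: I_def)
  show "(\<Sum>k\<in>I. pencil_const u (w, True) k * X k) = X (w, True) - X (w, False)"
    unfolding pencil_const_def
    by (simp add: left_diff_distrib sum_subtractf sum_of_bool_eq[OF fin mem(1)])
  show "(\<Sum>k\<in>I. pencil_const u (w, False) k * X k) = X (w, True) - X (tl w, False)" if "w \<noteq> []"
    unfolding pencil_const_def using that
    by (simp add: left_diff_distrib sum_subtractf sum_of_bool_eq[OF fin mem(1)] sum_of_bool_eq[OF fin mem(2)])
  have "(\<Sum>k\<in>I. pencil_const u ([], False) k * X k)
      = (\<Sum>w\<in>words n D. \<Sum>b\<in>UNIV. pencil_const u ([], False) (w, b) * X (w, b))"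
    by (simp add: I_def sum.cartesian_product)
  then show "(\<Sum>k\<in>I. pencil_const u ([], False) k * X k) = (\<Sum>w\<in>words n D. u w * X (w, False))"
    by (simp add: UNIV_bool pencil_const_def)
qed

text \<open>The right-hand side is scaled by \<open>c\<close> so that \<open>c = 1\<close> gives the solution and \<open>c = 0\<close> the kernel.\<close>

lemma pencil_solution:
  fixes X :: "nat list \<times> bool \<Rightarrow> real"
  assumes "\<forall>i\<in>words n D \<times> UNIV.
      (\<Sum>k\<in>words n D \<times> UNIV. pencil_const u i k * X k) + (\<Sum>j<n. pencil_linear i j * s $ j) * X i = c * pencil_rhs i"
  shows "\<And>w. w \<in> words n D \<Longrightarrow> X (w, False) = shifted_word w s * X ([], False)"
    and "\<And>w. w \<in> words n D \<Longrightarrow> w \<noteq> [] \<Longrightarrow> X (w, True) = X (tl w, False)"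
    and "X ([], True) = X ([], False)"
    and "(\<Sum>w\<in>words n D. u w * shifted_word w s) * X ([], False) = c"
proof -
  note eq = bspec[OF assms]
  have nil: "[] \<in> words n D" by (simp add: words_def)
  show step: "X (w, True) = X (tl w, False)" if "w \<in> words n D" "w \<noteq> []" for w
    using eq[of "(w, False)"] that pencil_const_rows(2)[OF that(1), where X = X and u = u]
    by (simp add: pencil_linear_def pencil_rhs_def)
  show "X ([], True) = X ([], False)"
    using eq[of "([], True)"] pencil_const_rows(1)[OF nil, where X = X and u = u] nil
    by (simp add: pencil_linear_def pencil_rhs_def)
  have var: "X (j # w, False) = (s $ j + 1) * X (j # w, True)" if "j # w \<in> words n D" for j w
  proof -
    have "j < n" using that by (simp add: words_def)
    have "(\<Sum>i<n. pencil_linear (j # w, True) i * s $ i) = (\<Sum>i<n. of_bool (i = j) * s $ i)"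
      by (intro sum.cong) (auto simp: pencil_linear_def)
    also have "\<dots> = s $ j" using \<open>j < n\<close> by (intro sum_of_bool_eq) auto
    finally show ?thesis
      using eq[of "(j # w, True)"] that pencil_const_rows(1)[OF that, where X = X and u = u]
      by (simp add: pencil_rhs_def algebra_simps)
  qed
  show words: "X (w, False) = shifted_word w s * X ([], False)" if "w \<in> words n D" for w
    using that
  proof (induction w)
    case (Cons j w)
    then have "w \<in> words n D" using words_tl by fastforce
    with Cons.IH var[OF Cons.prems] step[OF Cons.prems] show ?case by simp
  qed simp
  have "(\<Sum>w\<in>words n D. u w * X (w, False)) = c"
    using eq[of "([], False)"] nil pencil_const_rows(3)[OF nil, where X = X and u = u]
    by (simp add: pencil_linear_def pencil_rhs_def)
  then show "(\<Sum>w\<in>words n D. u w * shifted_word w s) * X ([], False) = c"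
    by (simp add: words sum_distrib_right mult.assoc)
qed

text \<open>All matrices are written out in components; row \<open>i\<close> of \<open>A + \<Delta>(K s)\<close> applied to \<open>x\<close>
  is the left-hand side of the last implication.\<close>

lemma rational_function_realization:
  assumes U0: "poly_val n U (0\<^sub>v n) = 1"
  obtains m A K b c where "1 \<le> m" "A \<in> carrier_mat m m" "K \<in> carrier_mat m n"
    "\<forall>i<m. \<forall>j<n. 0 \<le> K $$ (i, j)" "\<forall>i<m. b i \<in> {0, 1 :: real}"
    "\<forall>i<m. (\<Sum>k<m. A $$ (i, k)) = b i"
    "\<forall>x. (\<forall>i<m. (\<Sum>k<m. A $$ (i, k) * x k) = 0) \<longrightarrow> (\<forall>i<m. x i = (0 :: real))"
    "\<forall>s\<in>carrier_vec n. \<forall>x. (\<forall>i<m. (\<Sum>k<m. A $$ (i, k) * x k) + (\<Sum>j<n. K $$ (i, j) * s $ j) * x i = b i) \<longrightarrow>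
       poly_val n U s \<noteq> 0 \<and> poly_val n U s * (\<Sum>i<m. c i * x i) = poly_val n V s"
proof -
  obtain D1 where D1: "\<And>D. D \<ge> D1 \<Longrightarrow> \<exists>c. \<forall>s. poly_val n U s = (\<Sum>w\<in>words n D. c w * shifted_word w s)"
    using word_polynomial_coefficients[OF word_polynomial_poly_val] by blast
  obtain D2 where D2: "\<And>D. D \<ge> D2 \<Longrightarrow> \<exists>c. \<forall>s. poly_val n V s = (\<Sum>w\<in>words n D. c w * shifted_word w s)"
    using word_polynomial_coefficients[OF word_polynomial_poly_val] by blast
  define D where "D = max D1 D2"
  obtain u where u: "\<And>s. poly_val n U s = (\<Sum>w\<in>words n D. u w * shifted_word w s)"
    using D1[of D] by (auto simp: D_def)
  obtain v where v: "\<And>s. poly_val n V s = (\<Sum>w\<in>words n D. v w * shifted_word w s)"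
    using D2[of D] by (auto simp: D_def)
  define I where "I = words n D \<times> (UNIV :: bool set)"
  have fin: "finite I" by (simp add: I_def finite_words)
  have nil: "[] \<in> words n D" by (simp add: words_def)
  define m where "m = card I"
  obtain f where f: "bij_betw f {..<m} I"
    using ex_bij_betw_nat_finite[OF fin] by (auto simp: m_def atLeast0LessThan)
  have f_in: "f i \<in> I" if "i < m" for i using f that by (auto simp: bij_betw_def)
  define g where "g = inv_into {..<m} f"
  have gf: "g (f i) = i" if "i < m" for i
    using f that unfolding g_def by (intro inv_into_f_f) (auto simp: bij_betw_def)
  have I_ex: "\<exists>i<m. k = f i" if "k \<in> I" for k using f that by (auto simp: bij_betw_def)
  have sum_f: "(\<Sum>k<m. h (f k)) = (\<Sum>k\<in>I. h k)" for h :: "_ \<Rightarrow> real"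
    by (rule sum.reindex_bij_betw[OF f])
  define A where "A = Matrix.mat m m (\<lambda>(i, k). pencil_const u (f i) (f k))"
  define K where "K = Matrix.mat m n (\<lambda>(i, j). pencil_linear (f i) j)"
  define b where "b i = pencil_rhs (f i)" for i
  define c where "c i = (if snd (f i) then 0 else v (fst (f i)))" for i
  have A_sum: "(\<Sum>k<m. A $$ (i, k) * x k) = (\<Sum>k\<in>I. pencil_const u (f i) k * x (g k))" if "i < m" for i x
  proof -
    have "(\<Sum>k<m. A $$ (i, k) * x k) = (\<Sum>k<m. pencil_const u (f i) (f k) * x (g (f k)))"
      using that by (intro sum.cong) (auto simp: A_def gf)
    then show ?thesis unfolding sum_f[of "\<lambda>k. pencil_const u (f i) k * x (g k)"] .
  qed
  have K_sum: "(\<Sum>j<n. K $$ (i, j) * s $ j) = (\<Sum>j<n. pencil_linear (f i) j * s $ j)" if "i < m" for i s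
    using that by (intro sum.cong) (auto simp: K_def)
  have solve: "\<forall>i\<in>words n D \<times> UNIV. (\<Sum>k\<in>words n D \<times> UNIV. pencil_const u i k * x (g k)) + (\<Sum>j<n. pencil_linear i j * s $ j) * x (g i)
      = d * pencil_rhs i"
    if x: "\<forall>i<m. (\<Sum>k<m. A $$ (i, k) * x k) + (\<Sum>j<n. K $$ (i, j) * s $ j) * x i = d * b i"
    for x s d
  proof
    fix i :: "nat list \<times> bool" assume i: "i \<in> words n D \<times> UNIV"
    obtain i' where i': "i' < m" "i = f i'" using I_ex[of i] i by (auto simp: I_def)
    from x i'(1) have "(\<Sum>k<m. A $$ (i', k) * x k) + (\<Sum>j<n. K $$ (i', j) * s $ j) * x i' = d * b i'"
      by blast
    then show "(\<Sum>k\<in>words n D \<times> UNIV. pencil_const u i k * x (g k)) + (\<Sum>j<n. pencil_linear i j * s $ j) * x (g i)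
      = d * pencil_rhs i" using A_sum[OF i'(1), of x] K_sum[OF i'(1), of s]
      by (simp add: gf[OF i'(1)] b_def I_def i'(2))
  qed
  show thesis
  proof (rule that[of m A K b c])
    have "card I \<noteq> 0" using fin nil by (auto simp: I_def)
    then show "1 \<le> m" by (simp add: m_def)
    show "A \<in> carrier_mat m m" "K \<in> carrier_mat m n" by (simp_all add: A_def K_def)
    show "\<forall>i<m. \<forall>j<n. 0 \<le> K $$ (i, j)" by (simp add: K_def pencil_linear_def)
    show "\<forall>i<m. b i \<in> {0, 1}" by (simp add: b_def pencil_rhs_def)
    show "\<forall>i<m. (\<Sum>k<m. A $$ (i, k)) = b i"
    proof (intro allI impI)
      fix i assume i: "i < m"
      have sumu: "(\<Sum>w\<in>words n D. u w) = 1"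
      proof -
        have "shifted_word w (0\<^sub>v n) = 1" if "w \<in> words n D" for w
          using that by (induction w) (auto simp: words_def)
        then show ?thesis using u[of "0\<^sub>v n"] U0 by simp
      qed
      obtain w h where wh: "f i = (w, h)" by force
      then have w: "w \<in> words n D" using f_in[OF i] by (simp add: I_def)
      have "(\<Sum>k<m. A $$ (i, k)) = (\<Sum>k\<in>I. pencil_const u (w, h) k * 1)"
        using A_sum[OF i, of "\<lambda>_. 1"] by (simp add: wh)
      also have "\<dots> = pencil_rhs (w, h)"
        using pencil_const_rows[OF w, of u "\<lambda>_. 1"] sumu unfolding I_def
        by (cases h; cases "w = []") (simp_all add: pencil_rhs_def)
      finally show "(\<Sum>k<m. A $$ (i, k)) = b i" by (simp add: b_def wh)
    qed
    show "\<forall>x. (\<forall>i<m. (\<Sum>k<m. A $$ (i, k) * x k) = 0) \<longrightarrow> (\<forall>i<m. x i = (0 :: real))"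
    proof (intro allI impI)
      fix x :: "nat \<Rightarrow> real" and i
      assume ker: "\<forall>i<m. (\<Sum>k<m. A $$ (i, k) * x k) = 0" and i: "i < m"
      have "\<forall>i<m. (\<Sum>k<m. A $$ (i, k) * x k) + (\<Sum>j<n. K $$ (i, j) * (0\<^sub>v n) $ j) * x i = 0 * b i"
        using ker by simp
      note sol = pencil_solution[where X = "\<lambda>k. x (g k)" and u = u and n = n and D = D and s = "0\<^sub>v n" and c = 0, OF solve[OF this]]
      have x0: "x (g ([], False)) = 0" using sol(4) u[of "0\<^sub>v n"] U0 by simp
      obtain w h where wh: "f i = (w, h)" by force
      then have w: "w \<in> words n D" using f_in[OF i] by (simp add: I_def)
      have "x (g (w, h)) = 0"
      proof (cases h)
        case True
        then show ?thesis
          using sol(1)[OF words_tl[OF w]] sol(2)[OF w] sol(3) x0 by (cases "w = []") simp_all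
      next
        case False
        then show ?thesis using sol(1)[OF w] x0 by simp
      qed
      then show "x i = 0" using gf[OF i] by (simp add: wh)
    qed
    show "\<forall>s\<in>carrier_vec n. \<forall>x. (\<forall>i<m. (\<Sum>k<m. A $$ (i, k) * x k) + (\<Sum>j<n. K $$ (i, j) * s $ j) * x i = b i) \<longrightarrow>
       poly_val n U s \<noteq> 0 \<and> poly_val n U s * (\<Sum>i<m. c i * x i) = poly_val n V s"
    proof (intro ballI allI impI)
      fix s :: "real Matrix.vec" and x
      assume "\<forall>i<m. (\<Sum>k<m. A $$ (i, k) * x k) + (\<Sum>j<n. K $$ (i, j) * s $ j) * x i = b i"
      then have "\<forall>i<m. (\<Sum>k<m. A $$ (i, k) * x k) + (\<Sum>j<n. K $$ (i, j) * s $ j) * x i = 1 * b i" by simp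
      note sol = pencil_solution[where X = "\<lambda>k. x (g k)" and u = u and n = n and D = D and s = s and c = 1, OF solve[OF this]]
      have x0: "poly_val n U s * x (g ([], False)) = 1" using sol(4) u[of s] by simp
      have "(\<Sum>i<m. c i * x i) = (\<Sum>i<m. (if snd (f i) then 0 else v (fst (f i))) * x (g (f i)))"
        by (intro sum.cong) (auto simp: c_def gf)
      also have "\<dots> = (\<Sum>k\<in>I. (if snd k then 0 else v (fst k)) * x (g k))" by (rule sum_f)
      also have "\<dots> = (\<Sum>w\<in>words n D. \<Sum>h\<in>UNIV. (if h then 0 else v w) * x (g (w, h)))"
        by (simp add: I_def sum.cartesian_product case_prod_unfold)
      also have "\<dots> = (\<Sum>w\<in>words n D. v w * x (g (w, False)))" by (simp add: UNIV_bool)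
      also have "\<dots> = (\<Sum>w\<in>words n D. v w * (shifted_word w s * x (g ([], False))))"
        by (intro sum.cong refl) (simp only: sol(1))
      also have "\<dots> = poly_val n V s * x (g ([], False))"
        by (simp add: v sum_distrib_right mult.assoc)
      finally have "poly_val n U s * (\<Sum>i<m. c i * x i) = poly_val n V s * (poly_val n U s * x (g ([], False)))"
        by simp
      with x0 show "poly_val n U s \<noteq> 0 \<and> poly_val n U s * (\<Sum>i<m. c i * x i) = poly_val n V s" by auto
    qed
  qed
qed

section \<open>Stabilization of a pencil\<close>

lemma sum_lessThan_add: "(\<Sum>k<m + l. g k) = (\<Sum>k<m. g k) + (\<Sum>k<l. g (m + k :: nat) :: 'a :: comm_monoid_add)"
  by (induction l) (simp_all add: add.assoc)

text \<open>The block matrix with rows \<open>(p I, \<Gamma>)\<close> and \<open>(\<Gamma>\<^sup>-\<^sup>1 (p B - I), \<Gamma>\<^sup>-\<^sup>1 B \<Gamma>)\<close>, where \<open>\<Gamma>\<close> is the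
  diagonal matrix of \<open>\<gamma>\<close>. Eliminating the second half of the unknowns leaves \<open>B\<^sup>-\<^sup>1\<close>. The choice of
  \<open>\<Gamma>\<close> does not affect the eigenvalues; it serves to prescribe the row sums.\<close>

definition stab :: "nat \<Rightarrow> real \<Rightarrow> (nat \<Rightarrow> real) \<Rightarrow> (nat \<Rightarrow> nat \<Rightarrow> real) \<Rightarrow> nat \<Rightarrow> nat \<Rightarrow> real" where
  "stab m p \<gamma> B i k =
     (if i < m then if k < m then of_bool (k = i) * p else of_bool (k - m = i) * \<gamma> i
      else if k < m then (p * B (i - m) k - of_bool (k = i - m)) / \<gamma> (i - m)
      else B (i - m) (k - m) * \<gamma> (k - m) / \<gamma> (i - m))"

lemma sum_of_bool_lessThan:
  fixes g :: "nat \<Rightarrow> 'a :: semiring_1"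
  assumes "i < m"
  shows "(\<Sum>k<m. of_bool (k = i) * g k) = g i"
proof -
  have "(\<Sum>k<m. of_bool (k = i) * g k) = (\<Sum>k<m. if k = i then g k else 0)"
    by (intro sum.cong) auto
  with assms show ?thesis by simp
qed

lemma stab_upper_row:
  fixes x y :: "nat \<Rightarrow> 'a :: real_field"
  assumes "i < m"
  shows "(\<Sum>k<m. of_real (stab m p \<gamma> B i k) * x k) + (\<Sum>k<m. of_real (stab m p \<gamma> B i (m + k)) * y k)
    = of_real p * x i + of_real (\<gamma> i) * y i"
proof -
  have "(\<Sum>k<m. of_real (stab m p \<gamma> B i k) * x k) = (\<Sum>k<m. of_bool (k = i) * (of_real p * x k))"
    by (intro sum.cong) (auto simp: stab_def assms)
  moreover have "(\<Sum>k<m. of_real (stab m p \<gamma> B i (m + k)) * y k) = (\<Sum>k<m. of_bool (k = i) * (of_real (\<gamma> k) * y k))"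
    by (intro sum.cong) (auto simp: stab_def assms)
  ultimately show ?thesis by (simp only: sum_of_bool_lessThan[OF assms])
qed

lemma stab_lower_row:
  fixes x y :: "nat \<Rightarrow> 'a :: real_field"
  assumes i: "i < m" and "\<gamma> i \<noteq> 0"
  shows "of_real (\<gamma> i) * ((\<Sum>k<m. of_real (stab m p \<gamma> B (m + i) k) * x k)
      + (\<Sum>k<m. of_real (stab m p \<gamma> B (m + i) (m + k)) * y k))
    = (\<Sum>k<m. of_real (B i k) * (of_real p * x k + of_real (\<gamma> k) * y k)) - x i"
proof -
  have "of_real (\<gamma> i) * (\<Sum>k<m. of_real (stab m p \<gamma> B (m + i) k) * x k)
      = (\<Sum>k<m. of_real (B i k) * (of_real p * x k) - of_bool (k = i) * x k)"
    unfolding sum_distrib_left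
    by (intro sum.cong refl) (use assms in \<open>simp add: stab_def field_simps\<close>)
  also have "\<dots> = (\<Sum>k<m. of_real (B i k) * (of_real p * x k)) - x i"
    by (simp add: sum_subtractf sum_of_bool_lessThan[OF i])
  finally have 1: "of_real (\<gamma> i) * (\<Sum>k<m. of_real (stab m p \<gamma> B (m + i) k) * x k)
      = (\<Sum>k<m. of_real (B i k) * (of_real p * x k)) - x i" .
  have 2: "of_real (\<gamma> i) * (\<Sum>k<m. of_real (stab m p \<gamma> B (m + i) (m + k)) * y k)
      = (\<Sum>k<m. of_real (B i k) * (of_real (\<gamma> k) * y k))"
    unfolding sum_distrib_left
    by (intro sum.cong refl) (use assms in \<open>simp add: stab_def field_simps\<close>)
  show ?thesis by (simp add: distrib_left sum.distrib 1 2)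
qed

text \<open>Eliminating \<open>y\<close> shows that \<open>z + 1 / z - p\<close> is an eigenvalue of \<open>B\<close>, hence bounded by the sum of
  the moduli of the entries; and \<open>z\<close> and \<open>1 / z\<close> have real parts of the same sign.\<close>

lemma stab_eigenvalue_positive:
  fixes x y :: "nat \<Rightarrow> complex"
  assumes p: "(\<Sum>i<m. \<Sum>k<m. \<bar>B i k\<bar>) < p" and \<gamma>: "\<And>i. i < m \<Longrightarrow> \<gamma> i \<noteq> 0"
    and up: "\<And>i. i < m \<Longrightarrow> (\<Sum>k<m. of_real (stab m p \<gamma> B i k) * x k)
      + (\<Sum>k<m. of_real (stab m p \<gamma> B i (m + k)) * y k) = z * x i"
    and low: "\<And>i. i < m \<Longrightarrow> (\<Sum>k<m. of_real (stab m p \<gamma> B (m + i) k) * x k)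
      + (\<Sum>k<m. of_real (stab m p \<gamma> B (m + i) (m + k)) * y k) = z * y i"
    and nz: "\<exists>i<m. x i \<noteq> 0 \<or> y i \<noteq> 0"
  shows "Re z > 0"
proof -
  have r1: "of_real p * x i + of_real (\<gamma> i) * y i = z * x i" if "i < m" for i
    using up[OF that] stab_upper_row[OF that, of p \<gamma> B x y] by simp
  have r2: "z * (\<Sum>k<m. of_real (B i k) * x k) - x i = z * (z - of_real p) * x i" if i: "i < m" for i
  proof -
    have "(\<Sum>k<m. of_real (B i k) * (of_real p * x k + of_real (\<gamma> k) * y k)) - x i = of_real (\<gamma> i) * (z * y i)"
      using low[OF i] stab_lower_row[where \<gamma> = \<gamma> and i = i and m = m and p = p and B = B and x = x and y = y, OF i \<gamma>[OF i]] by simp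
    moreover have "(\<Sum>k<m. of_real (B i k) * (of_real p * x k + of_real (\<gamma> k) * y k)) = z * (\<Sum>k<m. of_real (B i k) * x k)"
      unfolding sum_distrib_left by (intro sum.cong refl) (simp add: r1)
    moreover have "of_real (\<gamma> i) * (z * y i) = z * (z - of_real p) * x i"
    proof -
      have "of_real (\<gamma> i) * (z * y i) = z * (of_real (\<gamma> i) * y i)" by simp
      also have "of_real (\<gamma> i) * y i = (z - of_real p) * x i" using r1[OF i] by (simp add: algebra_simps)
      finally show ?thesis by (simp only: mult.assoc)
    qed
    ultimately show ?thesis by simp
  qed
  have xnz: "\<exists>i<m. x i \<noteq> 0"
  proof (rule ccontr)
    assume "\<not> ?thesis"
    then have x0: "x i = 0" if "i < m" for i using that by blast
    have "y i = 0" if "i < m" for i using r1[OF that] x0[OF that] \<gamma>[OF that] by simp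
    with nz x0 show False by blast
  qed
  have z0: "z \<noteq> 0"
  proof
    assume "z = 0"
    then have "x i = 0" if "i < m" for i using r2[OF that] by simp
    with xnz show False by blast
  qed
  define \<nu> where "\<nu> = 1 / z + z - of_real p"
  have Bx: "(\<Sum>k<m. of_real (B i k) * x k) = \<nu> * x i" if "i < m" for i
    using r2[OF that] z0 by (simp add: \<nu>_def field_simps)
  define N where "N = (\<Sum>i<m. \<Sum>k<m. \<bar>B i k\<bar>)"
  have "finite {..<m}" "{..<m} \<noteq> {}" using xnz by auto
  \<comment> \<open>In the row of the largest entry of \<open>x\<close>, the sum of moduli bounds the eigenvalue \<open>\<nu>\<close>.\<close>
  then obtain i where i: "i < m" "\<forall>k<m. cmod (x k) \<le> cmod (x i)"
    using Max_in[of "(\<lambda>k. cmod (x k)) ` {..<m}"] Max_ge[of "(\<lambda>k. cmod (x k)) ` {..<m}"] by fastforce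
  have xi: "cmod (x i) > 0" using xnz i by force
  have "cmod \<nu> * cmod (x i) = cmod (\<Sum>k<m. of_real (B i k) * x k)" using Bx[OF i(1)] by (simp add: norm_mult)
  also have "\<dots> \<le> (\<Sum>k<m. \<bar>B i k\<bar> * cmod (x k))"
    by (rule order_trans[OF norm_sum]) (simp add: norm_mult)
  also have "\<dots> \<le> (\<Sum>k<m. \<bar>B i k\<bar> * cmod (x i))" using i(2) by (intro sum_mono mult_left_mono) auto
  also have "\<dots> = (\<Sum>k<m. \<bar>B i k\<bar>) * cmod (x i)" by (simp add: sum_distrib_right)
  also have "\<dots> \<le> N * cmod (x i)"
  proof (rule mult_right_mono)
    show "(\<Sum>k<m. \<bar>B i k\<bar>) \<le> N" unfolding N_def
      using i(1) by (intro member_le_sum[of i "{..<m}" "\<lambda>i. \<Sum>k<m. \<bar>B i k\<bar>"]) (auto intro: sum_nonneg)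
  qed simp
  finally have "cmod \<nu> \<le> N" using xi by simp
  then have "- N \<le> Re \<nu>" using abs_Re_le_cmod[of \<nu>] by linarith
  then have "Re (1 / z) + Re z > 0" using p by (simp add: \<nu>_def N_def)
  moreover have "Re (1 / z) = Re z / (cmod z)\<^sup>2"
    by (simp add: Re_divide cmod_power2)
  ultimately have "Re z * (1 / (cmod z)\<^sup>2 + 1) > 0" by (simp add: distrib_left)
  moreover have "1 / (cmod z)\<^sup>2 + 1 > 0" by (intro add_nonneg_pos) auto
  ultimately show ?thesis by (simp add: zero_less_mult_iff)
qed

lemma trivial_kernel_inverse:
  fixes A :: "real Matrix.mat"
  assumes A: "A \<in> carrier_mat m m"
    and ker: "\<forall>x. (\<forall>i<m. (\<Sum>k<m. A $$ (i, k) * x k) = 0) \<longrightarrow> (\<forall>i<m. x i = (0 :: real))"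
  obtains B where "\<And>x i. i < m \<Longrightarrow> (\<Sum>k<m. B i k * (\<Sum>l<m. A $$ (k, l) * x l)) = x i"
    "\<And>x i. i < m \<Longrightarrow> (\<Sum>k<m. A $$ (i, k) * (\<Sum>l<m. B k l * x l)) = x i"
proof -
  have comp: "(M *\<^sub>v Matrix.vec m x) $ i = (\<Sum>k<m. M $$ (i, k) * x k)"
    if "M \<in> carrier_mat m m" "i < m" for M :: "real Matrix.mat" and x i
    using that by (simp add: scalar_prod_def atLeast0LessThan)
  have "Determinant.det A \<noteq> 0"
  proof
    assume "Determinant.det A = 0"
    then obtain v where v: "v \<in> carrier_vec m" "v \<noteq> 0\<^sub>v m" "A *\<^sub>v v = 0\<^sub>v m"
      using det_0_iff_vec_prod_zero_field[OF A] by blast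
    have vv: "Matrix.vec m (\<lambda>i. v $ i) = v" using v(1) by auto
    have "(\<Sum>k<m. A $$ (i, k) * v $ k) = 0" if "i < m" for i
      using comp[OF A that, of "\<lambda>i. v $ i"] v(3) that by (simp add: vv)
    then have "\<forall>i<m. v $ i = 0" using ker by blast
    then have "v = 0\<^sub>v m" using v(1) by (intro eq_vecI) auto
    with v(2) show False by simp
  qed
  then have "mat_inverse A \<noteq> None"
    using mat_inverse(1)[OF A, where b = "()"] det_non_zero_imp_unit[OF A, where b = "()"] by blast
  then obtain R where "mat_inverse A = Some R" by blast
  from mat_inverse(2)[OF A this] have R: "A * R = 1\<^sub>m m" "R * A = 1\<^sub>m m" "R \<in> carrier_mat m m" by auto
  have prod: "(\<Sum>k<m. M $$ (i, k) * (\<Sum>l<m. N $$ (k, l) * x l)) = x i"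
    if "M * N = 1\<^sub>m m" "M \<in> carrier_mat m m" "N \<in> carrier_mat m m" "i < m" for M N :: "real Matrix.mat" and x i
  proof -
    have Nx: "N *\<^sub>v Matrix.vec m x = Matrix.vec m (\<lambda>k. \<Sum>l<m. N $$ (k, l) * x l)"
      by (rule eq_vecI) (use that comp[OF that(3)] in auto)
    have "x i = (1\<^sub>m m *\<^sub>v Matrix.vec m x) $ i" using that(4) by simp
    also have "1\<^sub>m m *\<^sub>v Matrix.vec m x = M *\<^sub>v (N *\<^sub>v Matrix.vec m x)"
      unfolding that(1)[symmetric] by (rule assoc_mult_mat_vec[OF that(2,3)]) simp
    also have "\<dots> $ i = (\<Sum>k<m. M $$ (i, k) * (\<Sum>l<m. N $$ (k, l) * x l))"
      unfolding Nx by (rule comp[OF that(2,4)])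
    finally show ?thesis by simp
  qed
  show thesis
    by (rule that[of "\<lambda>i k. R $$ (i, k)"]) (use prod[OF R(2,3) A] prod[OF R(1) A R(3)] in auto)
qed

section \<open>From a rational transform to a stable representation\<close>

lemma mult_mat_vec_sum:
  assumes "M \<in> carrier_mat r l" "w \<in> carrier_vec l" "i < r"
  shows "(M *\<^sub>v w) $ i = (\<Sum>k<l. M $$ (i, k) * w $ k)"
  using assms by (simp add: scalar_prod_def atLeast0LessThan)

lemma scalar_prod_sum: "w \<in> carrier_vec l \<Longrightarrow> v \<bullet> w = (\<Sum>k<l. v $ k * w $ k)"
  by (auto simp: scalar_prod_def atLeast0LessThan)

lemma resolvent_arg_row:
  assumes "T \<in> carrier_mat m m" "K \<in> carrier_mat m n" "s \<in> carrier_vec n" "x \<in> carrier_vec m" "i < m"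
  shows "(resolvent_arg m T K s *\<^sub>v x) $ i = (- T *\<^sub>v x) $ i + (\<Sum>j<n. K $$ (i, j) * s $ j) * x $ i"
proof -
  have "(resolvent_arg m T K s *\<^sub>v x) $ i = (- T *\<^sub>v x) $ i + (mat_diag m (\<lambda>i. (K *\<^sub>v s) $ i) *\<^sub>v x) $ i"
    unfolding resolvent_arg_def using assms
    by (subst add_mult_distrib_mat_vec[of _ m m])
      (auto simp: carrier_matD[OF mat_diag_dim] scalar_prod_def simp del: index_mult_mat_vec)
  also have "(mat_diag m (\<lambda>i. (K *\<^sub>v s) $ i) *\<^sub>v x) $ i = (\<Sum>k<m. of_bool (k = i) * ((K *\<^sub>v s) $ k * x $ k))"
    unfolding mult_mat_vec_sum[OF mat_diag_dim assms(4,5)]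
    by (intro sum.cong) (use assms in \<open>auto simp: mat_diag_def\<close>)
  also have "\<dots> = (K *\<^sub>v s) $ i * x $ i" by (rule sum_of_bool_lessThan[OF assms(5)])
  finally show ?thesis by (simp add: mult_mat_vec_sum[OF assms(2,3,5)])
qed

text \<open>The realization of \<open>V / U\<close> is stabilized with \<open>B = A\<^sup>-\<^sup>1\<close>, and \<open>K\<close> is extended by zero rows, so
  that eliminating the second half of the unknowns gives back the pencil \<open>A + \<Delta>(K s)\<close>. With
  \<open>\<gamma> i = b i - p\<close> the row sums of \<open>- T\<close> are \<open>b\<close> followed by zeros, which is the right-hand side
  wanted. Then \<open>\<alpha> \<bullet> ones\<close> is the value of \<open>V / U\<close> at 0, which is 1.\<close>

lemma (in nonneg_law) stable_representation:
  assumes U0: "poly_val n U (0\<^sub>v n) = 1"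
    and UV: "\<And>s. s \<in> laplace_domain n \<mu> \<Longrightarrow> laplace n \<mu> s * poly_val n U s = poly_val n V s"
  shows "\<exists>m \<alpha> T K.
       MME_representation n \<mu> m (1 - \<alpha> \<bullet> ones m) \<alpha> T (- T *\<^sub>v ones m) K \<and>
       0 \<le> \<alpha> \<bullet> ones m \<and> \<alpha> \<bullet> ones m \<le> 1 \<and>
       (\<forall>i<m. \<forall>j<n. 0 \<le> K $$ (i, j))"
proof -
  obtain m A K b c where m: "1 \<le> m" and A: "A \<in> carrier_mat m m" and K: "K \<in> carrier_mat m n"
    and K0: "\<forall>i<m. \<forall>j<n. 0 \<le> K $$ (i, j)" and b: "\<forall>i<m. b i \<in> {0, 1 :: real}"
    and A1: "\<forall>i<m. (\<Sum>k<m. A $$ (i, k)) = b i"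
    and ker: "\<forall>x. (\<forall>i<m. (\<Sum>k<m. A $$ (i, k) * x k) = 0) \<longrightarrow> (\<forall>i<m. x i = (0 :: real))"
    and real: "\<forall>s\<in>carrier_vec n. \<forall>x. (\<forall>i<m. (\<Sum>k<m. A $$ (i, k) * x k) + (\<Sum>j<n. K $$ (i, j) * s $ j) * x i = b i) \<longrightarrow>
       poly_val n U s \<noteq> 0 \<and> poly_val n U s * (\<Sum>i<m. c i * x i) = poly_val n V s"
    by (rule rational_function_realization[OF U0])
  obtain B where BA: "\<And>x i. i < m \<Longrightarrow> (\<Sum>k<m. B i k * (\<Sum>l<m. A $$ (k, l) * x l)) = x i"
    and AB: "\<And>x i. i < m \<Longrightarrow> (\<Sum>k<m. A $$ (i, k) * (\<Sum>l<m. B k l * x l)) = x i"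
    using trivial_kernel_inverse[OF A ker] by blast
  have Bb: "(\<Sum>k<m. B i k * b k) = 1" if "i < m" for i
  proof -
    have "(\<Sum>k<m. B i k * b k) = (\<Sum>k<m. B i k * (\<Sum>l<m. A $$ (k, l) * 1))"
      by (intro sum.cong) (use A1 in auto)
    then show ?thesis using BA[OF that, of "\<lambda>_. 1"] by simp
  qed
  \<comment> \<open>The summand 2 keeps \<open>p\<close> above the entries of \<open>b\<close>, so that no \<open>\<gamma> i\<close> vanishes.\<close>
  define p where "p = 2 + (\<Sum>i<m. \<Sum>k<m. \<bar>B i k\<bar>)"
  define \<gamma> where "\<gamma> i = b i - p" for i
  have "0 \<le> (\<Sum>i<m. \<Sum>k<m. \<bar>B i k\<bar>)" by (intro sum_nonneg) simp
  then have p: "p \<ge> 2" by (simp add: p_def)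
  have \<gamma>: "\<gamma> i \<noteq> 0" if "i < m" for i
    using b[rule_format, OF that] p by (auto simp: \<gamma>_def)
  define S where "S = Matrix.mat (m + m) (m + m) (\<lambda>(i, k). stab m p \<gamma> B i k)"
  define T where "T = - S"
  define K' where "K' = Matrix.mat (m + m) n (\<lambda>(i, j). if i < m then K $$ (i, j) else 0)"
  define \<alpha> where "\<alpha> = Matrix.vec (m + m) (\<lambda>i. if i < m then c i else 0)"
  have S: "S \<in> carrier_mat (m + m) (m + m)" and T: "T \<in> carrier_mat (m + m) (m + m)"
    and K': "K' \<in> carrier_mat (m + m) n" and \<alpha>: "\<alpha> \<in> carrier_vec (m + m)"
    by (simp_all add: S_def T_def K'_def \<alpha>_def)
  have mT: "- T = S" by (rule eq_matI) (simp_all add: T_def S_def)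
  have ones: "ones (m + m) \<in> carrier_vec (m + m)" by (simp add: ones_def)
  have S_row: "(S *\<^sub>v w) $ i = (\<Sum>k<m. stab m p \<gamma> B i k * w $ k) + (\<Sum>k<m. stab m p \<gamma> B i (m + k) * w $ (m + k))"
    if "w \<in> carrier_vec (m + m)" "i < m + m" for w i
    unfolding mult_mat_vec_sum[OF S that] sum_lessThan_add
    by (intro arg_cong2[where f = "(+)"] sum.cong) (use that in \<open>simp_all add: S_def\<close>)
  have S_up: "(S *\<^sub>v w) $ i = p * w $ i + \<gamma> i * w $ (m + i)" if "w \<in> carrier_vec (m + m)" "i < m" for w i
    using S_row[OF that(1), of i] stab_upper_row[OF that(2), of p \<gamma> B "\<lambda>k. w $ k" "\<lambda>k. w $ (m + k)"] that
    by simp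
  have S_low: "\<gamma> i * (S *\<^sub>v w) $ (m + i) = (\<Sum>k<m. B i k * (p * w $ k + \<gamma> k * w $ (m + k))) - w $ i"
    if "w \<in> carrier_vec (m + m)" "i < m" for w i
    using S_row[OF that(1), of "m + i"] that
      stab_lower_row[where \<gamma> = \<gamma> and i = i and m = m and p = p and B = B and x = "\<lambda>k. w $ k"
        and y = "\<lambda>k. w $ (m + k)", OF that(2) \<gamma>[OF that(2)]]
    by simp
  define t where "t = - T *\<^sub>v ones (m + m)"
  have t: "t \<in> carrier_vec (m + m)" using S by (simp add: t_def mT ones_def)
  have t_up: "t $ i = b i" if "i < m" for i
    using S_up[OF ones that] that by (simp add: t_def mT ones_def \<gamma>_def)
  have t_low: "t $ (m + i) = 0" if "i < m" for i
  proof -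
    have "\<gamma> i * t $ (m + i) = (\<Sum>k<m. B i k * b k) - 1"
      using S_low[OF ones that] that by (simp add: t_def mT ones_def \<gamma>_def)
    then show ?thesis using Bb[OF that] \<gamma>[OF that] by simp
  qed
  have stable: "hurwitz_stable T"
    unfolding hurwitz_stable_def
  proof (intro allI impI)
    fix z assume "eigenvalue (map_mat complex_of_real T) z"
    then obtain w where w: "w \<in> carrier_vec (m + m)" "w \<noteq> 0\<^sub>v (m + m)"
      "map_mat complex_of_real T *\<^sub>v w = z \<cdot>\<^sub>v w"
      unfolding eigenvalue_def eigenvector_def using T by auto
    have row: "(\<Sum>k<m. of_real (stab m p \<gamma> B i k) * w $ k) + (\<Sum>k<m. of_real (stab m p \<gamma> B i (m + k)) * w $ (m + k))
        = - z * w $ i" if "i < m + m" for i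
    proof -
      have "(map_mat complex_of_real T *\<^sub>v w) $ i = (\<Sum>k<m + m. - (of_real (stab m p \<gamma> B i k) * w $ k))"
        by (subst mult_mat_vec_sum[of _ "m + m" "m + m"])
          (use T w(1) that in \<open>auto intro!: sum.cong simp: T_def S_def\<close>)
      then show ?thesis using w(1,3) that by (simp add: sum_negf sum_lessThan_add)
    qed
    have "Re (- z) > 0"
    proof (rule stab_eigenvalue_positive[where m = m and p = p and \<gamma> = \<gamma> and B = B])
      show "(\<Sum>i<m. \<Sum>k<m. \<bar>B i k\<bar>) < p" by (simp add: p_def)
      show "\<gamma> i \<noteq> 0" if "i < m" for i by (rule \<gamma>[OF that])
      show "(\<Sum>k<m. of_real (stab m p \<gamma> B i k) * w $ k) + (\<Sum>k<m. of_real (stab m p \<gamma> B i (m + k)) * w $ (m + k)) = - z * w $ i"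
        if "i < m" for i using row[of i] that by simp
      show "(\<Sum>k<m. of_real (stab m p \<gamma> B (m + i) k) * w $ k) + (\<Sum>k<m. of_real (stab m p \<gamma> B (m + i) (m + k)) * w $ (m + k))
          = - z * w $ (m + i)" if "i < m" for i using row[of "m + i"] that by simp
      show "\<exists>i<m. w $ i \<noteq> 0 \<or> w $ (m + i) \<noteq> 0"
      proof (rule ccontr)
        assume *: "\<not> ?thesis"
        have "w $ i = 0" if "i < m + m" for i
          using * that by (cases "i < m") (auto dest: spec[of _ "i - m"])
        then have "w = 0\<^sub>v (m + m)" using w(1) by (intro eq_vecI) auto
        with w(2) show False by simp
      qed
    qed
    then show "Re z < 0" by simp
  qed
  have \<alpha>_prod: "\<alpha> \<bullet> w = (\<Sum>i<m. c i * w $ i)" if "w \<in> carrier_vec (m + m)" for w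
    unfolding scalar_prod_sum[OF that] sum_lessThan_add by (simp add: \<alpha>_def)
  have zero_dom: "0\<^sub>v n \<in> laplace_domain n \<mu>" by (rule orthant_in_domain) auto
  have "poly_val n U (0\<^sub>v n) * (\<Sum>i<m. c i * 1) = poly_val n V (0\<^sub>v n)"
    using real[rule_format, of "0\<^sub>v n" "\<lambda>_. 1"] A1 by simp
  then have \<alpha>1: "\<alpha> \<bullet> ones (m + m) = 1"
    using UV[OF zero_dom] U0 laplace_0 by (simp add: \<alpha>_prod[OF ones]) (simp add: ones_def)
  have repr: "laplace n \<mu> s = (1 - \<alpha> \<bullet> ones (m + m)) + \<alpha> \<bullet> (R *\<^sub>v t)"
    if s: "s \<in> laplace_domain n \<mu>" and R: "mat_inverse (resolvent_arg (m + m) T K' s) = Some R" for s R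
  proof -
    have sc: "s \<in> carrier_vec n" using s by (simp add: laplace_domain_def)
    define N where "N = resolvent_arg (m + m) T K' s"
    have N: "N \<in> carrier_mat (m + m) (m + m)" using T by (simp add: N_def resolvent_arg_def)
    have NR: "N * R = 1\<^sub>m (m + m)" "R \<in> carrier_mat (m + m) (m + m)"
      using mat_inverse(2)[OF N] R by (auto simp: N_def)
    define x where "x = R *\<^sub>v t"
    have x: "x \<in> carrier_vec (m + m)" using NR(2) t by (simp add: x_def)
    have "N *\<^sub>v x = t"
      using assoc_mult_mat_vec[OF N NR(2) t] NR(1) t by (simp add: x_def)
    then have row: "(S *\<^sub>v x) $ i + (\<Sum>j<n. K' $$ (i, j) * s $ j) * x $ i = t $ i" if "i < m + m" for i
      using resolvent_arg_row[OF T K' sc x that] by (simp add: N_def mT)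
    have up: "p * x $ i + \<gamma> i * x $ (m + i) + (\<Sum>j<n. K $$ (i, j) * s $ j) * x $ i = b i" if "i < m" for i
    proof -
      have "(\<Sum>j<n. K' $$ (i, j) * s $ j) = (\<Sum>j<n. K $$ (i, j) * s $ j)"
        by (intro sum.cong) (use that in \<open>auto simp: K'_def\<close>)
      then show ?thesis using row[of i] S_up[OF x that] t_up[OF that] that by simp
    qed
    have low: "(\<Sum>k<m. B i k * (p * x $ k + \<gamma> k * x $ (m + k))) = x $ i" if "i < m" for i
    proof -
      have "(\<Sum>j<n. K' $$ (m + i, j) * s $ j) = 0"
        by (intro sum.neutral) (use that in \<open>auto simp: K'_def\<close>)
      then have "(S *\<^sub>v x) $ (m + i) = 0" using row[of "m + i"] t_low[OF that] that by simp
      then show ?thesis using S_low[OF x that] by simp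
    qed
    have "(\<Sum>k<m. A $$ (i, k) * x $ k) + (\<Sum>j<n. K $$ (i, j) * s $ j) * x $ i = b i" if "i < m" for i
    proof -
      have "(\<Sum>k<m. A $$ (i, k) * x $ k) = (\<Sum>k<m. A $$ (i, k) * (\<Sum>l<m. B k l * (p * x $ l + \<gamma> l * x $ (m + l))))"
        by (intro sum.cong) (simp_all add: low)
      also have "\<dots> = p * x $ i + \<gamma> i * x $ (m + i)" by (rule AB[OF that])
      finally show ?thesis using up[OF that] by simp
    qed
    then have "poly_val n U s \<noteq> 0" "poly_val n U s * (\<Sum>i<m. c i * x $ i) = poly_val n V s"
      using real[rule_format, OF sc, of "\<lambda>i. x $ i"] by auto
    then have "laplace n \<mu> s = (\<Sum>i<m. c i * x $ i)"
      using UV[OF s] by (metis mult.commute mult_left_cancel)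
    then show ?thesis using \<alpha>1 \<alpha>_prod[OF x] by (simp add: x_def)
  qed
  have "MME_representation n \<mu> (m + m) (1 - \<alpha> \<bullet> ones (m + m)) \<alpha> T (- T *\<^sub>v ones (m + m)) K'"
    unfolding MME_representation_def t_def[symmetric]
    using m \<alpha> T t K' stable repr by simp
  moreover have "\<forall>i<m + m. \<forall>j<n. 0 \<le> K' $$ (i, j)" using K0 by (simp add: K'_def)
  ultimately show ?thesis using \<alpha>1
    by (intro exI[of _ "m + m"] exI[of _ \<alpha>] exI[of _ T] exI[of _ K']) simp
qed

lemma MVME_representation:
  assumes "\<mu> \<in> MVME n"
  shows "\<exists>m \<alpha> T K.
       MME_representation n \<mu> m (1 - \<alpha> \<bullet> ones m) \<alpha> T (- T *\<^sub>v ones m) K \<and>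
       0 \<le> \<alpha> \<bullet> ones m \<and> \<alpha> \<bullet> ones m \<le> 1 \<and>
       (\<forall>i<m. \<forall>j<n. 0 \<le> K $$ (i, j))"
proof -
  from assms obtain P Q where law: "\<mu> \<in> nonneg_laws n" and PQ: "P \<in> polys n" "Q \<in> polys n" "Q \<noteq> 0"
    and eq: "\<forall>s\<in>laplace_domain n \<mu>. poly_val n Q s \<noteq> 0 \<longrightarrow> laplace n \<mu> s = poly_val n P s / poly_val n Q s"
    unfolding MVME_def by blast
  interpret nonneg_law n \<mu> by unfold_locales (rule law)
  have "laplace n \<mu> s * poly_val n Q s = poly_val n P s" if "s \<in> laplace_domain n \<mu>" for s
    by (rule rational_identity_on_domain[OF PQ(2,3) _ that]) (use eq in simp)
  then interpret rational_law n \<mu> P Q by unfold_locales (use PQ in auto)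
  obtain U V where "poly_val n U (0\<^sub>v n) = 1"
    "\<And>s. s \<in> laplace_domain n \<mu> \<Longrightarrow> laplace n \<mu> s * poly_val n U s = poly_val n V s"
    using denominator_normalizable by blast
  then show ?thesis by (rule stable_representation)
qed

section \<open>Every representation has a proper rational transform\<close>

lemma det_in_polys:
  fixes M :: "rpoly Matrix.mat"
  assumes "M \<in> carrier_mat m m" "\<And>i j. i < m \<Longrightarrow> j < m \<Longrightarrow> M $$ (i, j) \<in> polys n"
  shows "Determinant.det M \<in> polys n"
proof -
  have "signof \<pi> * (\<Prod>i=0..<m. M $$ (i, \<pi> i)) \<in> polys n" if \<pi>: "\<pi> permutes {0..<m}" for \<pi>
  proof (rule polys_mult)
    show "(signof \<pi> :: rpoly) \<in> polys n" by (auto simp: sign_def polys_1 polys_uminus)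
    show "(\<Prod>i=0..<m. M $$ (i, \<pi> i)) \<in> polys n"
      using permutes_in_image[OF \<pi>] by (intro polys_prod assms(2)) auto
  qed
  then show ?thesis unfolding det_def'[OF assms(1)] by (intro polys_sum) auto
qed

lemma adj_mat_in_polys:
  fixes M :: "rpoly Matrix.mat"
  assumes M: "M \<in> carrier_mat m m" "\<And>i j. i < m \<Longrightarrow> j < m \<Longrightarrow> M $$ (i, j) \<in> polys n"
    and ij: "i < m" "j < m"
  shows "adj_mat M $$ (i, j) \<in> polys n"
proof -
  have "Determinant.det (mat_delete M j i) \<in> polys n"
  proof (rule det_in_polys)
    show "mat_delete M j i \<in> carrier_mat (m - 1) (m - 1)" using M(1) by (auto simp: mat_delete_def)
    show "mat_delete M j i $$ (i', j') \<in> polys n" if "i' < m - 1" "j' < m - 1" for i' j'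
      using that M(1) by (auto simp: mat_delete_def intro!: M(2))
  qed
  moreover have "(-1) ^ e \<in> polys n" for e
    by (induction e) (auto intro: polys_1 polys_mult polys_uminus)
  ultimately have "cofactor M j i \<in> polys n" unfolding cofactor_def by (rule polys_mult[rotated])
  then show ?thesis using M(1) ij by (simp add: adj_mat_def)
qed

text \<open>If \<open>P\<close> had the larger degree, then along a suitable ray into the orthant it would outgrow \<open>Q\<close>,
  while the transform stays bounded by 1.\<close>

lemma (in nonneg_law) rational_transform_proper:
  assumes P: "P \<in> polys n" and Q0: "poly_val n Q (0\<^sub>v n) \<noteq> 0"
    and eq: "\<And>s. s \<in> laplace_domain n \<mu> \<Longrightarrow> poly_val n Q s \<noteq> 0 \<Longrightarrow>
      laplace n \<mu> s = poly_val n P s / poly_val n Q s"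
  shows "total_deg n P \<le> total_deg n Q"
proof (rule ccontr)
  assume "\<not> ?thesis"
  then have less: "total_deg n Q < total_deg n P" by simp
  have "total_deg n P \<in> insert 0 ((\<lambda>a. \<Sum>j<n. Poly_Mapping.lookup a j) ` Poly_Mapping.keys P)"
    unfolding total_deg_def by (rule Max_in) auto
  then obtain a where a: "a \<in> Poly_Mapping.keys P" "exponent_sum n a = total_deg n P"
    using less by (auto simp: exponent_sum_def)
  obtain v where v: "v \<in> carrier_vec n" "\<And>j. j < n \<Longrightarrow> v $ j > 0"
    "Polynomial.coeff (ray_poly n v P) (exponent_sum n a) \<noteq> 0"
    using exists_coeff_ray_nonzero[OF P a(1)] by blast
  define p where "p = ray_poly n v P"
  define q where "q = ray_poly n v Q"
  have "0 \<cdot>\<^sub>v v = 0\<^sub>v n" using v(1) by auto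
  then have "poly q 0 \<noteq> 0" using Q0 by (simp add: q_def poly_ray_poly[OF v(1)])
  then have "q \<noteq> 0" by auto
  have "Polynomial.degree q \<le> total_deg n Q"
  proof (rule degree_le, intro allI impI)
    fix i assume "total_deg n Q < i"
    then have "{a \<in> Poly_Mapping.keys Q. exponent_sum n a = i} = {}"
      using exponent_sum_le_total_deg[of _ Q n] by fastforce
    then show "Polynomial.coeff q i = 0" unfolding q_def coeff_ray_poly by (simp only: sum.empty)
  qed
  also have "\<dots> < Polynomial.degree p"
    using less le_degree[OF v(3)] by (simp add: a(2) p_def)
  finally have deg: "Polynomial.degree q < Polynomial.degree p" .
  then have "p \<noteq> 0" by auto
  have "Polynomial.degree (q * q) < Polynomial.degree (p * p)"
    using deg \<open>q \<noteq> 0\<close> \<open>p \<noteq> 0\<close> by (simp add: degree_mult_eq)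
  then have "lead_coeff (p * p - q * q) = lead_coeff (p * p)"
    using lead_coeff_add_le[of "- (q * q)" "p * p"] by simp
  also have "\<dots> > 0"
    unfolding lead_coeff_mult zero_less_mult_iff using leading_coeff_neq_0[OF \<open>p \<noteq> 0\<close>] by linarith
  finally obtain X where X: "\<And>x. x \<ge> X \<Longrightarrow> poly (p * p - q * q) x > 0"
    using poly_pinfty_gt_lc[of "p * p - q * q"] by (metis less_le_trans)
  have "infinite {max X 1..}" by (rule infinite_Ici)
  then obtain x where x: "x \<ge> X" "x \<ge> 1" "poly q x \<noteq> 0"
    using poly_roots_finite[OF \<open>q \<noteq> 0\<close>] finite_subset[of "{max X 1..}" "{x. poly q x = 0}"] by fastforce
  have nonneg: "0 \<le> (x \<cdot>\<^sub>v v) $ j" if "j < n" for j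
    using v x that by (auto intro: less_imp_le)
  have carr: "x \<cdot>\<^sub>v v \<in> carrier_vec n" using v(1) by simp
  have "laplace n \<mu> (x \<cdot>\<^sub>v v) = poly p x / poly q x"
    using eq[OF orthant_in_domain[OF carr nonneg]] x(3) by (simp add: p_def q_def poly_ray_poly[OF v(1)])
  moreover have "0 \<le> laplace n \<mu> (x \<cdot>\<^sub>v v)" "laplace n \<mu> (x \<cdot>\<^sub>v v) \<le> 1"
    using laplace_bounds[OF carr nonneg] by auto
  ultimately have "\<bar>poly p x / poly q x\<bar> \<le> 1" by simp
  then have "\<bar>poly p x\<bar> \<le> \<bar>poly q x\<bar>" using x(3) by (simp add: abs_divide pos_divide_le_eq)
  then have "poly p x * poly p x \<le> poly q x * poly q x" by (simp add: abs_le_square_iff power2_eq_square)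
  with X[OF x(1)] show False by simp
qed

text \<open>A real kernel vector would be an eigenvector of \<open>T\<close> with eigenvalue 0.\<close>

lemma hurwitz_stable_det_nonzero:
  assumes T: "T \<in> carrier_mat m m" and st: "hurwitz_stable T"
  shows "Determinant.det (- T) \<noteq> 0"
proof
  have mT: "- T \<in> carrier_mat m m" using T by simp
  assume "Determinant.det (- T) = 0"
  then obtain v where v: "v \<in> carrier_vec m" "v \<noteq> 0\<^sub>v m" "- T *\<^sub>v v = 0\<^sub>v m"
    using det_0_iff_vec_prod_zero_field[OF mT] by blast
  have "- (T *\<^sub>v v) = 0\<^sub>v m" using v(3) T v(1) by simp
  then have Tv: "T *\<^sub>v v = 0\<^sub>v m" using T v(1) by (metis mult_mat_vec_carrier uminus_uminus_vec uminus_zero_vec)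
  have "map_mat complex_of_real T *\<^sub>v map_vec complex_of_real v = map_vec complex_of_real (T *\<^sub>v v)"
    by (rule of_real_hom.mult_mat_vec_hom[OF T v(1), symmetric])
  also have "\<dots> = 0 \<cdot>\<^sub>v map_vec complex_of_real v" using v(1) by (auto simp: Tv)
  finally have "eigenvector (map_mat complex_of_real T) (map_vec complex_of_real v) 0"
    unfolding eigenvector_def using T v(1,2) by (auto simp: vec_eq_iff)
  then have "eigenvalue (map_mat complex_of_real T) 0" unfolding eigenvalue_def by blast
  with st have "Re 0 < 0" unfolding hurwitz_stable_def by blast
  then show False by simp
qed

text \<open>Cramer's rule over the ring of polynomials: the entries of the resolvent argument become
  polynomials, and \<open>Q\<close> is the determinant of that matrix. Stability makes \<open>Q\<close> nonzero at 0.\<close>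

lemma MME_star_subset_MVME: "MME_star n \<subseteq> MVME n"
proof
  fix \<mu> assume "\<mu> \<in> MME_star n"
  then obtain m p0 \<alpha> T t K where law: "\<mu> \<in> nonneg_laws n" and rep: "MME_representation n \<mu> m p0 \<alpha> T t K"
    unfolding MME_star_def by blast
  then have \<alpha>: "\<alpha> \<in> carrier_vec m" and T: "T \<in> carrier_mat m m" and t: "t \<in> carrier_vec m"
    and K: "K \<in> carrier_mat m n" and st: "hurwitz_stable T"
    and id: "\<And>s R. s \<in> laplace_domain n \<mu> \<Longrightarrow> mat_inverse (resolvent_arg m T K s) = Some R \<Longrightarrow>
        laplace n \<mu> s = p0 + \<alpha> \<bullet> (R *\<^sub>v t)"
    unfolding MME_representation_def by auto
  interpret nonneg_law n \<mu> by unfold_locales (rule law)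
  define M where "M = Matrix.mat m m (\<lambda>(i, k). Poly_Mapping.single 0 (- T $$ (i, k))
      + (if i = k then \<Sum>j<n. Poly_Mapping.single 0 (K $$ (i, j)) * rvar j else 0))"
  have M: "M \<in> carrier_mat m m" by (simp add: M_def)
  have M_polys: "M $$ (i, k) \<in> polys n" if "i < m" "k < m" for i k
    using that by (auto simp: M_def intro!: polys_add polys_sum polys_mult polys_const polys_rvar polys_0)
  have M_val: "map_mat (\<lambda>P. poly_val n P s) M = resolvent_arg m T K s" if "s \<in> carrier_vec n" for s
  proof (rule eq_matI)
    show "dim_row (map_mat (\<lambda>P. poly_val n P s) M) = dim_row (resolvent_arg m T K s)"
      "dim_col (map_mat (\<lambda>P. poly_val n P s) M) = dim_col (resolvent_arg m T K s)"
      by (simp_all add: M_def resolvent_arg_def mat_diag_def)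
    fix i k assume "i < dim_row (resolvent_arg m T K s)" "k < dim_col (resolvent_arg m T K s)"
    then have ik: "i < m" "k < m" by (simp_all add: resolvent_arg_def mat_diag_def)
    have "poly_val n (\<Sum>j<n. Poly_Mapping.single 0 (K $$ (i, j)) * rvar j) s = (K *\<^sub>v s) $ i"
      unfolding mult_mat_vec_sum[OF K that ik(1)] poly_val_sum poly_val_mult
      by (intro sum.cong) (simp_all add: poly_val_rvar)
    then show "map_mat (\<lambda>P. poly_val n P s) M $$ (i, k) = resolvent_arg m T K s $$ (i, k)"
      using ik T by (cases "k = i") (simp_all add: M_def resolvent_arg_def mat_diag_def poly_val_add)
  qed
  define Q where "Q = Determinant.det M"
  define P where "P = Poly_Mapping.single 0 p0 * Q
    + (\<Sum>i<m. \<Sum>k<m. Poly_Mapping.single 0 (\<alpha> $ i * t $ k) * adj_mat M $$ (i, k))"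
  have Q: "Q \<in> polys n" unfolding Q_def by (rule det_in_polys[OF M M_polys])
  have P: "P \<in> polys n" unfolding P_def
    by (intro polys_add polys_mult polys_sum polys_const Q adj_mat_in_polys[OF M M_polys]) auto
  have Q_val: "poly_val n Q s = Determinant.det (resolvent_arg m T K s)" if "s \<in> carrier_vec n" for s
  proof -
    interpret h: comm_ring_hom "\<lambda>P. poly_val n P s" by (rule comm_ring_hom_poly_val)
    show ?thesis using h.hom_det[of M] M_val[OF that] by (simp add: Q_def)
  qed
  have Q0: "poly_val n Q (0\<^sub>v n) \<noteq> 0"
  proof -
    have "resolvent_arg m T K (0\<^sub>v n) = - T"
      by (rule eq_matI) (use T K in \<open>auto simp: resolvent_arg_def mat_diag_def\<close>)
    then show ?thesis using hurwitz_stable_det_nonzero[OF T st] by (simp add: Q_val)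
  qed
  have eq: "laplace n \<mu> s = poly_val n P s / poly_val n Q s"
    if s: "s \<in> laplace_domain n \<mu>" and nz: "poly_val n Q s \<noteq> 0" for s
  proof -
    have sc: "s \<in> carrier_vec n" using s by (simp add: laplace_domain_def)
    interpret h: comm_ring_hom "\<lambda>P. poly_val n P s" by (rule comm_ring_hom_poly_val)
    define N where "N = resolvent_arg m T K s"
    have N: "N \<in> carrier_mat m m" using T by (simp add: N_def resolvent_arg_def)
    have "Determinant.det N \<noteq> 0" using nz Q_val[OF sc] by (simp add: N_def)
    then have "mat_inverse N \<noteq> None"
      using mat_inverse(1)[OF N, where b = "()"] det_non_zero_imp_unit[OF N, where b = "()"] by blast
    then obtain R where R: "mat_inverse N = Some R" by blast
    from mat_inverse(2)[OF N R] have RN: "R * N = 1\<^sub>m m" and Rc: "R \<in> carrier_mat m m" by auto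
    define J where "J = map_mat (\<lambda>P. poly_val n P s) (adj_mat M)"
    have J: "J \<in> carrier_mat m m" using adj_mat(1)[OF M] by (simp add: J_def)
    have "N * J = map_mat (\<lambda>P. poly_val n P s) (M * adj_mat M)"
      unfolding J_def N_def M_val[OF sc, symmetric] by (rule h.mat_hom_mult[OF M adj_mat(1)[OF M], symmetric])
    also have "\<dots> = poly_val n Q s \<cdot>\<^sub>m 1\<^sub>m m"
      unfolding adj_mat(2)[OF M] Q_def[symmetric] by (rule eq_matI) (auto simp: poly_val_mult)
    finally have NJ: "N * J = poly_val n Q s \<cdot>\<^sub>m 1\<^sub>m m" .
    have "J = R * (N * J)"
      using assoc_mult_mat[OF Rc N J] RN J by simp
    also have "\<dots> = poly_val n Q s \<cdot>\<^sub>m R"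
      unfolding NJ using Rc by (simp add: mult_smult_distrib[OF Rc one_carrier_mat])
    finally have JR: "J = poly_val n Q s \<cdot>\<^sub>m R" .
    have "\<alpha> \<bullet> (R *\<^sub>v t) = (\<Sum>i<m. \<alpha> $ i * (\<Sum>k<m. R $$ (i, k) * t $ k))"
      using Rc t by (subst scalar_prod_sum[of _ m]) (auto intro!: sum.cong simp: mult_mat_vec_sum[OF Rc t] simp del: index_mult_mat_vec)
    then have "poly_val n Q s * (\<alpha> \<bullet> (R *\<^sub>v t)) = (\<Sum>i<m. \<Sum>k<m. \<alpha> $ i * t $ k * (poly_val n Q s * R $$ (i, k)))"
      by (simp add: sum_distrib_left mult_ac)
    also have "\<dots> = (\<Sum>i<m. \<Sum>k<m. poly_val n (Poly_Mapping.single 0 (\<alpha> $ i * t $ k) * adj_mat M $$ (i, k)) s)"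
    proof (intro sum.cong refl)
      fix i k assume "i \<in> {..<m}" "k \<in> {..<m}"
      then have "poly_val n (adj_mat M $$ (i, k)) s = poly_val n Q s * R $$ (i, k)"
        using arg_cong[OF JR, of "\<lambda>X. X $$ (i, k)"] adj_mat(1)[OF M] Rc by (simp add: J_def)
      then show "\<alpha> $ i * t $ k * (poly_val n Q s * R $$ (i, k))
          = poly_val n (Poly_Mapping.single 0 (\<alpha> $ i * t $ k) * adj_mat M $$ (i, k)) s"
        by (simp add: poly_val_mult)
    qed
    finally have "poly_val n P s = poly_val n Q s * (p0 + \<alpha> \<bullet> (R *\<^sub>v t))"
      by (simp add: P_def poly_val_add poly_val_mult poly_val_sum distrib_left)
    then show ?thesis using id[OF s R[unfolded N_def]] nz by simp
  qed
  have "Q \<noteq> 0" using Q0 by auto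
  moreover have "total_deg n P \<le> total_deg n Q" by (rule rational_transform_proper[OF P Q0 eq])
  ultimately show "\<mu> \<in> MVME n" unfolding MVME_def using law P Q eq by blast
qed

theorem theorem3p6:
  fixes n :: nat
  assumes "n \<ge> 2"
  shows "MVME n = MME_star n \<and>
    (\<forall>\<mu> \<in> MVME n. \<exists>m \<alpha> T K.
       MME_representation n \<mu> m (1 - \<alpha> \<bullet> ones m) \<alpha> T (- T *\<^sub>v ones m) K \<and>
       0 \<le> \<alpha> \<bullet> ones m \<and> \<alpha> \<bullet> ones m \<le> 1 \<and>
       (\<forall>i<m. \<forall>j<n. 0 \<le> K $$ (i, j)))"
proof -
  have "MVME n \<subseteq> MME_star n"
  proof
    fix \<mu> assume "\<mu> \<in> MVME n"
    moreover then have "\<mu> \<in> nonneg_laws n" by (simp add: MVME_def)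
    ultimately show "\<mu> \<in> MME_star n" using MVME_representation[of \<mu> n] unfolding MME_star_def by blast
  qed
  then show ?thesis using MME_star_subset_MVME[of n] MVME_representation by blast
qed

end
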